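(* Fix $\theta\in\mathbb{R}$. There exists a constant $C>0$, independent of $n$, such that for every $n$ and every density $f:\Omega_n\to\mathbb{R}$ with respect to $\nu_U^n$, $$H_n(f|\nu_U^n)\le C\left(n^2D_n^{\rm ex}(f;\nu_U^n)+\sqrt n\,D_n^{\rm G}(f;\nu_U^n)\right).$$ In particular, for every $n$ and every density $f:\Omega_n\to\mathbb{R}$ with respect to $\nu_U^n$, $$H_n(f|\nu_U^n)\le C\sqrt n\,D_n(f;\nu_U^n).$$
   Context: Throughout $n$ ranges over positive integers with $n>\theta^2$. $\mathbb{T}_n=\mathbb{Z}/n\mathbb{Z}$, $\Omega_n=\{0,1\}^{\mathbb{T}_n}$, $\sigma(x)=2\eta(x)-1$, $\gamma=\gamma_n=\frac12\left(1-\frac{\theta}{\sqrt n}\right)\in(0,1)$, and $$c_x(\eta)=1-\gamma\sigma(x)(\sigma(x-1)+\sigma(x+1))+\gamma^2\sigma(x-1)\sigma(x+1).$$ $\eta^{x,x+1}$ is $\eta$ with the values at $x$ and $x+1$ exchanged; $\eta^x$ is $\eta$ with the value at $x$ replaced by $1-\eta(x)$. For $\varrho\in[-1/2,1/2]$, $U(\varrho)=\frac1\gamma\{[1+2\gamma\varrho]\log[1+2\gamma\varrho]+[1-2\gamma\varrho]\log[1-2\gamma\varrho]\}$. Let $\nu^n_{1/2}$ be the uniform probability measure on $\Omega_n$ and let $\nu_U^n$ be the probability measure $$\nu_U^n(\eta)=\frac{1}{Z_U^n}\exp\Big\{nU\Big(\frac1n\sum_{x\in\mathbb{T}_n}(\eta(x)-1/2)\Big)\Big\}\,\nu^n_{1/2}(\eta),$$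 with $Z_U^n$ the normalizing constant. A density with respect to $\nu_U^n$ is a function $f\ge0$ with $\int f\,d\nu_U^n=1$. For such $f$ (with $0\log0=0$), $$H_n(f|\nu_U^n)=\int f\log f\,d\nu_U^n,\qquad D_n^{\rm ex}(f;\nu_U^n)=\frac12\sum_{x\in\mathbb{T}_n}\int\{\sqrt{f(\eta^{x,x+1})}-\sqrt{f(\eta)}\}^2d\nu_U^n,$$ $$D_n^{\rm G}(f;\nu_U^n)=\frac12\sum_{x\in\mathbb{T}_n}\int c_x(\eta)\{\sqrt{f(\eta^{x})}-\sqrt{f(\eta)}\}^2d\nu_U^n,\qquad D_n=n^2D_n^{\rm ex}+D_n^{\rm G}.$$ *)

theory Defs
  imports "HOL-Probability.Probability"
begin

text \<open>
  The discrete torus with \<open>n\<close> sites is represented by the residues \<open>{..<n}\<close>, with neighbours taken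
  modulo \<open>n\<close>; configurations are extensional functions on it, so that the configuration space is
  a finite set with \<open>2 ^ n\<close> elements.
\<close>

definition succ_site :: "nat \<Rightarrow> nat \<Rightarrow> nat" where
  "succ_site n x = (x + 1) mod n"

definition pred_site :: "nat \<Rightarrow> nat \<Rightarrow> nat" where
  "pred_site n x = (x + n - 1) mod n"

definition Omega :: "nat \<Rightarrow> (nat \<Rightarrow> nat) set" where
  "Omega n = ({..<n} \<rightarrow>\<^sub>E {0, 1})"

definition spin :: "(nat \<Rightarrow> nat) \<Rightarrow> nat \<Rightarrow> real" where
  "spin \<eta> x = 2 * real (\<eta> x) - 1"

definition exchange :: "nat \<Rightarrow> nat \<Rightarrow> (nat \<Rightarrow> nat) \<Rightarrow> (nat \<Rightarrow> nat)" where
  "exchange x y \<eta> = \<eta>(x := \<eta> y, y := \<eta> x)"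

definition flip :: "nat \<Rightarrow> (nat \<Rightarrow> nat) \<Rightarrow> (nat \<Rightarrow> nat)" where
  "flip x \<eta> = \<eta>(x := 1 - \<eta> x)"

definition gam :: "real \<Rightarrow> nat \<Rightarrow> real" where
  "gam \<theta> n = (1 / 2) * (1 - \<theta> / sqrt (real n))"

definition glauber_rate :: "real \<Rightarrow> nat \<Rightarrow> nat \<Rightarrow> (nat \<Rightarrow> nat) \<Rightarrow> real" where
  "glauber_rate \<theta> n x \<eta> =
     1 - gam \<theta> n * spin \<eta> x * (spin \<eta> (pred_site n x) + spin \<eta> (succ_site n x))
       + (gam \<theta> n)\<^sup>2 * spin \<eta> (pred_site n x) * spin \<eta> (succ_site n x)"

definition potential :: "real \<Rightarrow> nat \<Rightarrow> real \<Rightarrow> real" where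
  "potential \<theta> n \<rho> =
     (1 / gam \<theta> n) * ((1 + 2 * gam \<theta> n * \<rho>) * ln (1 + 2 * gam \<theta> n * \<rho>)
                     + (1 - 2 * gam \<theta> n * \<rho>) * ln (1 - 2 * gam \<theta> n * \<rho>))"

definition nu_half :: "nat \<Rightarrow> (nat \<Rightarrow> nat) measure" where
  "nu_half n = uniform_count_measure (Omega n)"

definition nu_U_weight :: "real \<Rightarrow> nat \<Rightarrow> (nat \<Rightarrow> nat) \<Rightarrow> real" where
  "nu_U_weight \<theta> n \<eta> =
     exp (real n * potential \<theta> n ((1 / real n) * (\<Sum>x<n. real (\<eta> x) - 1 / 2)))"

definition Z_U :: "real \<Rightarrow> nat \<Rightarrow> real" where
  "Z_U \<theta> n = (\<integral>\<eta>. nu_U_weight \<theta> n \<eta> \<partial>nu_half n)"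

definition nu_U :: "real \<Rightarrow> nat \<Rightarrow> (nat \<Rightarrow> nat) measure" where
  "nu_U \<theta> n = density (nu_half n) (\<lambda>\<eta>. ennreal (nu_U_weight \<theta> n \<eta> / Z_U \<theta> n))"

definition prob_density_wrt :: "'a measure \<Rightarrow> ('a \<Rightarrow> real) \<Rightarrow> bool" where
  "prob_density_wrt M f \<longleftrightarrow>
     f \<in> borel_measurable M \<and> (\<forall>\<eta>\<in>space M. 0 \<le> f \<eta>) \<and> (\<integral>\<eta>. f \<eta> \<partial>M) = 1"

text \<open>The convention \<open>0 * log 0 = 0\<close> holds automatically, since \<open>0 * ln 0 = 0\<close> in HOL.\<close>

definition rel_entropy :: "('a \<Rightarrow> real) \<Rightarrow> 'a measure \<Rightarrow> real" where
  "rel_entropy f M = (\<integral>\<eta>. f \<eta> * ln (f \<eta>) \<partial>M)"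

definition D_ex :: "nat \<Rightarrow> ((nat \<Rightarrow> nat) \<Rightarrow> real) \<Rightarrow> (nat \<Rightarrow> nat) measure \<Rightarrow> real" where
  "D_ex n f M =
     (1 / 2) * (\<Sum>x<n. \<integral>\<eta>. (sqrt (f (exchange x (succ_site n x) \<eta>)) - sqrt (f \<eta>))\<^sup>2 \<partial>M)"

definition D_G :: "real \<Rightarrow> nat \<Rightarrow> ((nat \<Rightarrow> nat) \<Rightarrow> real) \<Rightarrow> (nat \<Rightarrow> nat) measure \<Rightarrow> real" where
  "D_G \<theta> n f M =
     (1 / 2) * (\<Sum>x<n. \<integral>\<eta>. glauber_rate \<theta> n x \<eta> * (sqrt (f (flip x \<eta>)) - sqrt (f \<eta>))\<^sup>2 \<partial>M)"

definition D_total :: "real \<Rightarrow> nat \<Rightarrow> ((nat \<Rightarrow> nat) \<Rightarrow> real) \<Rightarrow> (nat \<Rightarrow> nat) measure \<Rightarrow> real" where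
  "D_total \<theta> n f M = (real n)\<^sup>2 * D_ex n f M + D_G \<theta> n f M"

lemma finite_Omega: "finite (Omega n)"
  by (simp add: Omega_def finite_PiE)

lemma card_Omega: "card (Omega n) = 2 ^ n"
  by (simp add: Omega_def card_PiE numeral_2_eq_2)

lemma Omega_nonempty: "Omega n \<noteq> {}"
  using card_Omega[of n] by force

lemma exchange_in_Omega:
  "\<eta> \<in> Omega n \<Longrightarrow> x < n \<Longrightarrow> exchange x (succ_site n x) \<eta> \<in> Omega n"
  by (auto simp: Omega_def exchange_def succ_site_def PiE_iff extensional_def)

lemma flip_in_Omega: "\<eta> \<in> Omega n \<Longrightarrow> x < n \<Longrightarrow> flip x \<eta> \<in> Omega n"
  by (auto simp: Omega_def flip_def PiE_iff extensional_def)

lemma gam_bounds: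
  assumes "n > 0" "\<theta>\<^sup>2 < real n"
  shows "0 < gam \<theta> n" "gam \<theta> n < 1"
proof -
  have "\<bar>\<theta>\<bar> < sqrt (real n)"
    using assms by (metis real_sqrt_abs real_sqrt_less_iff)
  then have "\<theta> / sqrt (real n) < 1" "- 1 < \<theta> / sqrt (real n)"
    using assms by (auto simp: field_simps abs_less_iff)
  then show "0 < gam \<theta> n" "gam \<theta> n < 1"
    by (auto simp: gam_def)
qed

lemma space_nu_U [simp]: "space (nu_U \<theta> n) = Omega n"
  by (simp add: nu_U_def nu_half_def space_uniform_count_measure)

lemma sets_nu_U [simp]: "sets (nu_U \<theta> n) = Pow (Omega n)"
  by (simp add: nu_U_def nu_half_def sets_uniform_count_measure)

lemma integral_nu_half: "(\<integral>\<eta>. g \<eta> \<partial>nu_half n) = (\<Sum>\<eta>\<in>Omega n. g \<eta>) / 2 ^ n" for g :: "_ \<Rightarrow> real"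
  by (simp add: nu_half_def uniform_count_measure_def lebesgue_integral_point_measure_finite
      finite_Omega card_Omega sum_divide_distrib)

lemma Z_U_pos: "0 < Z_U \<theta> n"
  unfolding Z_U_def integral_nu_half
  by (intro divide_pos_pos sum_pos finite_Omega Omega_nonempty) (auto simp: nu_U_weight_def)

lemma integral_nu_U:
  fixes g :: "(nat \<Rightarrow> nat) \<Rightarrow> real"
  shows "(\<integral>\<eta>. g \<eta> \<partial>nu_U \<theta> n) = (\<Sum>\<eta>\<in>Omega n. nu_U_weight \<theta> n \<eta> / Z_U \<theta> n * g \<eta>) / 2 ^ n"
proof -
  have m: "h \<in> borel_measurable (nu_half n)" for h :: "(nat \<Rightarrow> nat) \<Rightarrow> real"
    by (simp add: nu_half_def uniform_count_measure_def)
  have "(\<integral>\<eta>. g \<eta> \<partial>nu_U \<theta> n) = (\<integral>\<eta>. nu_U_weight \<theta> n \<eta> / Z_U \<theta> n * g \<eta> \<partial>nu_half n)"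
    unfolding nu_U_def
    by (subst integral_density) (use Z_U_pos[of \<theta> n] m in \<open>auto simp: nu_U_weight_def less_imp_le\<close>)
  then show ?thesis by (simp only: integral_nu_half)
qed

lemma prob_space_nu_U: "prob_space (nu_U \<theta> n)"
proof
  have Z: "Z_U \<theta> n > 0" by (rule Z_U_pos)
  have int: "integrable (nu_half n) h" for h :: "(nat \<Rightarrow> nat) \<Rightarrow> real"
    by (simp add: nu_half_def uniform_count_measure_def integrable_point_measure_finite finite_Omega)
  have "emeasure (nu_U \<theta> n) (space (nu_U \<theta> n)) =
      (\<integral>\<^sup>+\<eta>. ennreal (nu_U_weight \<theta> n \<eta> / Z_U \<theta> n) \<partial>nu_half n)"
    unfolding nu_U_def
    by (subst emeasure_density)
      (auto simp: nu_half_def uniform_count_measure_def intro!: nn_integral_cong)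
  also have "\<dots> = ennreal (\<integral>\<eta>. nu_U_weight \<theta> n \<eta> / Z_U \<theta> n \<partial>nu_half n)"
    using Z by (intro nn_integral_eq_integral int) (auto simp: nu_U_weight_def less_imp_le)
  also have "(\<integral>\<eta>. nu_U_weight \<theta> n \<eta> / Z_U \<theta> n \<partial>nu_half n) = 1"
    using Z by (simp add: Z_U_def[symmetric])
  finally show "emeasure (nu_U \<theta> n) (space (nu_U \<theta> n)) = 1" by simp
qed

end

theory Submission
  imports Defs
begin

text \<open>
  The Glauber part alone controls the entropy: \<open>H \<le> C * sqrt n * D_G\<close>. Up to constants, \<open>nu_U\<close> is a mixture
  of product Bernoulli measures: with \<open>S = \<Sum>\<sigma>(x)\<close> and \<open>\<tau> = \<gamma> S / n\<close>, the function
  \<open>t \<mapsto> (1 + t) powr (n/\<gamma> + S) * (1 - t) powr (n/\<gamma> - S)\<close> is maximal at \<open>\<tau>\<close> with value \<open>exp (n U)\<close>, and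
  Laplace's method shows that its integral is comparable to \<open>exp (n U) / sqrt n\<close>; as a function of \<open>\<eta>\<close>
  it is a multiple of the Bernoulli weight with field \<open>2 artanh t\<close>.
  On the scale \<open>t = s / q\<close>, \<open>q = n powr (1/4)\<close>, the mixing law has density \<open>exp (- V s)\<close> where \<open>V\<close> is
  quartic, uniformly in \<open>n\<close>, so it satisfies a log-Sobolev inequality with constant \<open>O(1)\<close>.
  The entropy splits into the average entropy under the Bernoulli measures, which tensorizes and costs
  \<open>O(1)\<close> Dirichlet forms, and the entropy of \<open>F s = E_s f\<close> under the mixing law; by Russo's formula
  and Cauchy-Schwarz \<open>((sqrt F)')\<^sup>2\<close> is at most \<open>O(n / q\<^sup>2) = O(sqrt n)\<close> Dirichlet forms.
\<close>

section \<open>Entropy gap\<close>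

text \<open>Entropies under \<open>nu_U\<close>, under the mixture and under each Bernoulli law are
  centred at different means. \<open>ent_gap\<close>, the Bregman divergence of x ln x, removes the
  centring: it is nonnegative pointwise, and its mean under a probability measure bounds the entropy
  from above for every c > 0, with equality when c is a positive mean. Hence two-sided bounds on the
  ratio of the weights transfer the inequality from one measure to another (as in Holley-Stroock),
  and whatever c the one-dimensional inequality delivers can be kept to the end.

  That inequality cannot come from convexity: V has second derivative 2 b at 0, and b has the sign
  of \<theta>, so V may be flat there or a double well. A Lyapunov argument replaces convexity:
  outside a core, the square of v = V' dominates both V and V''.

  The field variable is cut off at |t| \<le> T < 1, which keeps the Bernoulli parameters away from 0
  and 1, and \<open>gam\<close> stays in a compact part of (0,1) over all admissible n. All
  constants therefore depend on \<theta> alone.\<close>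

definition ent_gap :: "real \<Rightarrow> real \<Rightarrow> real" where
  "ent_gap x c = x * ln x - x * ln c - x + c"

lemma ent_gap_nonneg:
  assumes "0 \<le> x" "0 < c"
  shows "0 \<le> ent_gap x c"
proof (cases "x = 0")
  case False
  then have x: "0 < x" using assms by simp
  have "ln (c / x) \<le> c / x - 1"
    using x assms by (intro ln_le_minus_one) auto
  then have "x * (ln c - ln x) \<le> x * (c / x - 1)"
    using x assms by (intro mult_left_mono) (auto simp: ln_div)
  then show ?thesis using x by (simp add: ent_gap_def algebra_simps)
qed (use assms in \<open>simp add: ent_gap_def\<close>)

text \<open>By scaling only z = y / c matters. The left side vanishes to second order at z = 1,
  which gives the quadratic factor; for large z a logarithm is unavoidable. It is expressed through
  (y - c)^2 / c^2 so that a pointwise bound on y - c can be inserted later.\<close>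

lemma ent_gap_square_le:
  assumes y: "0 < y" and c: "0 < c"
  shows "ent_gap (y\<^sup>2) (c\<^sup>2) \<le> (y - c)\<^sup>2 * (8 + 4 * max 0 (ln ((y - c)\<^sup>2 / c\<^sup>2)))"
proof -
  define z where "z = y / c"
  have z: "0 < z" and yz: "y = c * z" using y c by (auto simp: z_def)
  have lny: "ln (y\<^sup>2) = 2 * ln z + ln (c\<^sup>2)"
    using z c by (simp add: yz ln_mult power_mult_distrib ln_realpow)
  have 1: "ent_gap (y\<^sup>2) (c\<^sup>2) = c\<^sup>2 * (2 * z\<^sup>2 * ln z - z\<^sup>2 + 1)"
    unfolding ent_gap_def lny by (simp add: yz algebra_simps power_mult_distrib)
  have 2: "(y - c)\<^sup>2 = c\<^sup>2 * (z - 1)\<^sup>2" by (simp add: yz power2_eq_square algebra_simps)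
  have 3: "(y - c)\<^sup>2 / c\<^sup>2 = (z - 1)\<^sup>2" using c by (simp add: 2)
  have "2 * z\<^sup>2 * ln z - z\<^sup>2 + 1 \<le> (z - 1)\<^sup>2 * (8 + 4 * max 0 (ln ((z - 1)\<^sup>2)))"
  proof (cases "z \<le> 2")
    case True
    have "2 * z\<^sup>2 * ln z \<le> 2 * z\<^sup>2 * (z - 1)"
      using z by (intro mult_left_mono ln_le_minus_one) auto
    \<comment> \<open>The right side is the exact factorisation of 2 z^3 - 3 z^2 + 1.\<close>
    then have "2 * z\<^sup>2 * ln z - z\<^sup>2 + 1 \<le> (z - 1)\<^sup>2 * (2 * z + 1)"
      by (simp add: power2_eq_square algebra_simps)
    also have "\<dots> \<le> (z - 1)\<^sup>2 * (8 + 4 * max 0 (ln ((z - 1)\<^sup>2)))"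
      using True by (intro mult_left_mono) auto
    finally show ?thesis .
  next
    case False
    have l: "ln z \<le> 1 + ln (z - 1)"
    proof -
      have "ln z \<le> ln (2 * (z - 1))" using False by simp
      also have "\<dots> = ln 2 + ln (z - 1)" using False by (subst ln_mult) auto
      finally show ?thesis using ln_2_less_1 by linarith
    qed
    have l0: "0 \<le> ln (z - 1)" using False by simp
    have "z\<^sup>2 \<le> (2 * (z - 1))\<^sup>2" using False by (intro power_mono) auto
    then have "2 * z\<^sup>2 * ln z \<le> 2 * (2 * (z - 1))\<^sup>2 * (1 + ln (z - 1))"
      using False l l0 by (intro mult_mono) auto
    also have "\<dots> = (z - 1)\<^sup>2 * (8 + 4 * ln ((z - 1)\<^sup>2))"
      using False unfolding power_mult_distrib by (simp add: ln_realpow algebra_simps)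
    also have "\<dots> \<le> (z - 1)\<^sup>2 * (8 + 4 * max 0 (ln ((z - 1)\<^sup>2)))"
      by (intro mult_left_mono) auto
    finally have "2 * z\<^sup>2 * ln z \<le> (z - 1)\<^sup>2 * (8 + 4 * max 0 (ln ((z - 1)\<^sup>2)))" .
    moreover have "1 \<le> z\<^sup>2" using False by simp
    ultimately show ?thesis by linarith
  qed
  then have "c\<^sup>2 * (2 * z\<^sup>2 * ln z - z\<^sup>2 + 1) \<le> c\<^sup>2 * ((z - 1)\<^sup>2 * (8 + 4 * max 0 (ln ((z - 1)\<^sup>2))))"
    by (intro mult_left_mono) auto
  then show ?thesis unfolding 3 unfolding 1 2 by (simp add: algebra_simps)
qed

section \<open>Log-Sobolev inequality for a confining potential on an interval\<close>

lemma integral_le_cont: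
  fixes f g :: "real \<Rightarrow> real"
  assumes "continuous_on {a..b} f" "continuous_on {a..b} g" "\<And>x. x \<in> {a..b} \<Longrightarrow> f x \<le> g x"
  shows "integral {a..b} f \<le> integral {a..b} g"
  using assms by (intro integral_le integrable_continuous_interval)

lemma integral_subinterval_le:
  fixes f :: "real \<Rightarrow> real"
  assumes "continuous_on {a..b} f" "\<And>x. x \<in> {a..b} \<Longrightarrow> 0 \<le> f x" "a \<le> c" "d \<le> b"
  shows "integral {c..d} f \<le> integral {a..b} f"
  using assms by (intro integral_subset_le integrable_continuous_interval)
    (auto intro: continuous_on_subset)

lemma increment_square_le:
  fixes f f' :: "real \<Rightarrow> real"
  assumes ab: "a < b"
    and d: "\<And>x. x \<in> {a..b} \<Longrightarrow> (f has_real_derivative f' x) (at x within {a..b})"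
    and c: "continuous_on {a..b} f'"
  shows "(f b - f a)\<^sup>2 \<le> (b - a) * integral {a..b} (\<lambda>x. (f' x)\<^sup>2)"
proof -
  \<comment> \<open>Cauchy-Schwarz in the form that the integral of (f' - m)^2 is nonnegative, with
    m the mean slope.\<close>
  define m where "m = (f b - f a) / (b - a)"
  have I: "(f' has_integral (f b - f a)) {a..b}"
    using ab d by (intro fundamental_theorem_of_calculus)
      (auto simp: has_real_derivative_iff_has_vector_derivative)
  have J: "((\<lambda>x. (f' x)\<^sup>2) has_integral integral {a..b} (\<lambda>x. (f' x)\<^sup>2)) {a..b}"
    by (intro integrable_integral integrable_continuous_interval continuous_intros c)
  have K: "((\<lambda>x. m\<^sup>2) has_integral (b - a) *\<^sub>R m\<^sup>2) {a..b}"
    using has_integral_const_real[of "m\<^sup>2" a b] ab by simp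
  have "((\<lambda>x. (f' x)\<^sup>2 - 2 * m * f' x + m\<^sup>2) has_integral
      (integral {a..b} (\<lambda>x. (f' x)\<^sup>2) - 2 * m * (f b - f a) + (b - a) *\<^sub>R m\<^sup>2)) {a..b}"
    by (intro has_integral_add has_integral_diff J K has_integral_mult_right I)
  moreover have "0 \<le> (f' x)\<^sup>2 - 2 * m * f' x + m\<^sup>2" for x
    using zero_le_power2[of "f' x - m"] by (simp add: power2_eq_square algebra_simps)
  ultimately have "0 \<le> integral {a..b} (\<lambda>x. (f' x)\<^sup>2) - 2 * m * (f b - f a) + (b - a) *\<^sub>R m\<^sup>2"
    by (rule has_integral_nonneg)
  then have "0 \<le> integral {a..b} (\<lambda>x. (f' x)\<^sup>2) - 2 * m * (f b - f a) + (b - a) * m\<^sup>2"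
    unfolding real_scaleR_def .
  moreover have *: "f b - f a = m * (b - a)" using ab by (simp add: m_def)
  ultimately have "2 * m * (m * (b - a)) - (b - a) * m\<^sup>2 \<le> integral {a..b} (\<lambda>x. (f' x)\<^sup>2)"
    by simp
  moreover have "2 * m * (m * (b - a)) - (b - a) * m\<^sup>2 = m\<^sup>2 * (b - a)"
    by (simp add: power2_eq_square algebra_simps)
  ultimately have "(b - a) * (m\<^sup>2 * (b - a)) \<le> (b - a) * integral {a..b} (\<lambda>x. (f' x)\<^sup>2)"
    using ab by (intro mult_left_mono) auto
  moreover have "(f b - f a)\<^sup>2 = (b - a) * (m\<^sup>2 * (b - a))"
    unfolding * by (simp only: power2_eq_square mult_ac)
  ultimately show ?thesis by simp
qed

lemma increment_le_integral_bound:
  fixes f f' B :: "real \<Rightarrow> real"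
  assumes d: "\<And>x. x \<in> {a..b} \<Longrightarrow> (f has_real_derivative f' x) (at x within {a..b})"
    and B: "continuous_on {a..b} B" "\<And>x. x \<in> {a..b} \<Longrightarrow> \<bar>f' x\<bar> \<le> B x"
    and xy: "x \<in> {a..b}" "y \<in> {a..b}"
  shows "f x - f y \<le> integral {a..b} B"
proof -
  have *: "\<bar>f d - f c\<bar> \<le> integral {a..b} B" if cd: "c \<le> d" "c \<in> {a..b}" "d \<in> {a..b}" for c d
  proof -
    have sub: "{c..d} \<subseteq> {a..b}" using cd by auto
    have I: "(f' has_integral (f d - f c)) {c..d}"
      using cd sub by (intro fundamental_theorem_of_calculus)
        (auto simp: has_real_derivative_iff_has_vector_derivative[symmetric] 
          intro!: DERIV_subset[OF d])
    have J: "(B has_integral integral {c..d} B) {c..d}"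
      using sub by (intro integrable_integral integrable_continuous_interval)
        (auto intro: continuous_on_subset[OF B(1)])
    have "norm (integral {c..d} f') \<le> integral {c..d} B"
      using sub B(2) I J by (intro integral_norm_bound_integral) (auto simp: integrable_on_def)
    also have "\<dots> \<le> integral {a..b} B"
      using B(2) cd by (intro integral_subinterval_le B(1)) (auto intro: order_trans[OF abs_ge_zero])
    finally show ?thesis using integral_unique[OF I] by simp
  qed
  show ?thesis
    using *[of x y] *[of y x] xy by (cases "x \<le> y") (auto simp: abs_le_iff)
qed

section \<open>From Lyapunov drift bounds to Poincare and log-Sobolev inequalities\<close>

definition poincare_const :: "real \<Rightarrow> real \<Rightarrow> real" where
  "poincare_const A R = 8 + 4 * (A + 1) * (2 * R * (exp A * (R * (exp A))))"

text \<open>Collected from the end of \<open>log_sobolev\<close>, per unit of energy: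
  \<open>2 * poincare_const A R\<close> bounds the integral of w h^2,
  \<open>6 + 6 * A * poincare_const A R\<close> bounds that of w h^2 v^2, and
  \<open>4 * (A + 1) * (2 * R * exp A)\<close> bounds the total mass.\<close>

definition log_sobolev_const :: "real \<Rightarrow> real \<Rightarrow> real" where
  "log_sobolev_const A R =
     (14 + 8 * A + 8 * (4 * (A + 1) * (2 * R * exp A))) * (2 * poincare_const A R)
     + (4 * A + 2) * (6 + 6 * A * poincare_const A R) + 4"

text \<open>Data for a log-Sobolev constant that depends on A and R but not on L.
  \<open>boundary\<close> makes V nondecreasing outwards at the endpoints, so that integration by
  parts leaves a boundary term of the right sign. \<open>outer\<close> lets v^2 absorb v' and also
  V, the logarithm of 1 / w. \<open>A_ge\<close> keeps the interval long enough to average over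
  it.\<close>

locale confining_potential =
  fixes V v v' :: "real \<Rightarrow> real" and L R A :: real
  assumes L_pos: "0 < L" and R_pos: "0 < R" and A_ge: "1 / L \<le> A"
    and deriv_V: "\<And>s. s \<in> {-L..L} \<Longrightarrow> (V has_real_derivative v s) (at s within {-L..L})"
    and deriv_v: "\<And>s. s \<in> {-L..L} \<Longrightarrow> (v has_real_derivative v' s) (at s within {-L..L})"
    and cont_v': "continuous_on {-L..L} v'"
    and boundary: "0 \<le> v L" "v (- L) \<le> 0"
    and inner: "\<And>s. s \<in> {-L..L} \<Longrightarrow> \<bar>s\<bar> \<le> R \<Longrightarrow> \<bar>V s\<bar> \<le> A \<and> v' s \<le> A"
    and outer: "\<And>s. s \<in> {-L..L} \<Longrightarrow> R \<le> \<bar>s\<bar> \<Longrightarrow>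
      V s \<le> A * (v s)\<^sup>2 \<and> 1 \<le> (v s)\<^sup>2 \<and> v' s \<le> (v s)\<^sup>2 / 8"
begin

definition w :: "real \<Rightarrow> real" where "w s = exp (- V s)"

lemma A_pos: "0 < A"
  using A_ge L_pos by (meson less_le_trans zero_less_divide_1_iff)

lemma cont_V: "continuous_on {-L..L} V" and cont_v: "continuous_on {-L..L} v"
  by (rule DERIV_continuous_on, erule deriv_V) (rule DERIV_continuous_on, erule deriv_v)

lemma cont_w: "continuous_on {-L..L} w"
  unfolding w_def by (intro continuous_intros cont_V)

lemma w_pos: "0 < w s" by (simp add: w_def)

lemma w_nonneg [simp]: "0 \<le> w s" using w_pos[of s] by simp

lemma deriv_w: "s \<in> {-L..L} \<Longrightarrow> (w has_real_derivative (- v s * w s)) (at s within {-L..L})"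
  unfolding w_def by (auto intro!: derivative_eq_intros deriv_V)

lemmas cont = continuous_intros cont_w cont_v cont_v'

text \<open>Integrate the derivative of w h^2 v. Its boundary term is nonnegative, and the cross
  term 2 h h' v is at most 2 h'^2 + h^2 v^2 / 2.\<close>

lemma by_parts:
  assumes dh: "\<And>s. s \<in> {-L..L} \<Longrightarrow> (h has_real_derivative h' s) (at s within {-L..L})"
    and ch: "continuous_on {-L..L} h'"
  shows "integral {-L..L} (\<lambda>s. w s * (h s)\<^sup>2 * ((v s)\<^sup>2 / 2 - v' s)) \<le> 2 * integral {-L..L} (\<lambda>s. w s * (h' s)\<^sup>2)"
proof -
  have cth: "continuous_on {-L..L} h" by (rule DERIV_continuous_on) (rule dh)
  define K where "K s = w s * (h s)\<^sup>2 * v s" for s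
  define K' where "K' s = - w s * (h s)\<^sup>2 * (v s)\<^sup>2 + 2 * w s * h s * h' s * v s + w s * (h s)\<^sup>2 * v' s" for s
  have dK: "(K has_real_derivative K' s) (at s within {-L..L})" if "s \<in> {-L..L}" for s
    unfolding K_def K'_def
    by (rule derivative_eq_intros deriv_w dh deriv_v refl that)+
      (simp add: power2_eq_square algebra_simps)
  have I: "(K' has_integral (K L - K (-L))) {-L..L}"
    using L_pos dK by (intro fundamental_theorem_of_calculus)
      (auto simp: has_real_derivative_iff_has_vector_derivative)
  have KL: "0 \<le> K L - K (-L)"
  proof -
    have "K (- L) \<le> 0" unfolding K_def using boundary by (intro mult_nonneg_nonpos) auto
    moreover have "0 \<le> K L" unfolding K_def using boundary by (intro mult_nonneg_nonneg) auto
    ultimately show ?thesis by simp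
  qed
  have cK': "continuous_on {-L..L} K'"
    unfolding K'_def by (intro cont cth ch)
  have "0 \<le> integral {-L..L} K'" using KL integral_unique[OF I] by simp
  also have "\<dots> \<le> integral {-L..L} (\<lambda>s. 2 * (w s * (h' s)\<^sup>2) - w s * (h s)\<^sup>2 * ((v s)\<^sup>2 / 2 - v' s))"
  proof (intro integral_le_cont cK' cont cth ch)
    fix s
    have "0 \<le> w s * (2 * (h' s - h s * v s / 2)\<^sup>2)" by simp
    then show "K' s \<le> 2 * (w s * (h' s)\<^sup>2) - w s * (h s)\<^sup>2 * ((v s)\<^sup>2 / 2 - v' s)"
      unfolding K'_def by (simp add: power2_eq_square algebra_simps)
  qed simp
  also have "\<dots> = integral {-L..L} (\<lambda>s. 2 * (w s * (h' s)\<^sup>2)) -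
      integral {-L..L} (\<lambda>s. w s * (h s)\<^sup>2 * ((v s)\<^sup>2 / 2 - v' s))"
    by (intro integral_diff integrable_continuous_interval cont cth ch) auto
  finally show ?thesis by simp
qed

text \<open>On the whole interval v' is at most v^2 / 8 + A, so the weight in
  \<open>by_parts\<close> is at least 3/8 v^2 - A. This makes v^2, and through it V, integrable
  against w h^2 at the cost of the energy.\<close>

lemma lyapunov_drift_weight:
  assumes dh: "\<And>s. s \<in> {-L..L} \<Longrightarrow> (h has_real_derivative h' s) (at s within {-L..L})"
    and ch: "continuous_on {-L..L} h'"
  shows "3 * integral {-L..L} (\<lambda>s. w s * (h s)\<^sup>2 * (v s)\<^sup>2) \<le>
    16 * integral {-L..L} (\<lambda>s. w s * (h' s)\<^sup>2) + 8 * A * integral {-L..L} (\<lambda>s. w s * (h s)\<^sup>2)"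
proof -
  have cth: "continuous_on {-L..L} h" by (rule DERIV_continuous_on) (rule dh)
  have "3 / 8 * integral {-L..L} (\<lambda>s. w s * (h s)\<^sup>2 * (v s)\<^sup>2) - A * integral {-L..L} (\<lambda>s. w s * (h s)\<^sup>2)
     = integral {-L..L} (\<lambda>s. 3 / 8 * (w s * (h s)\<^sup>2 * (v s)\<^sup>2)) - integral {-L..L} (\<lambda>s. A * (w s * (h s)\<^sup>2))"
    by simp
  also have "\<dots> = integral {-L..L} (\<lambda>s. 3 / 8 * (w s * (h s)\<^sup>2 * (v s)\<^sup>2) - A * (w s * (h s)\<^sup>2))"
    by (intro integral_diff[symmetric] integrable_continuous_interval cont cth)
  also have "\<dots> \<le> integral {-L..L} (\<lambda>s. w s * (h s)\<^sup>2 * ((v s)\<^sup>2 / 2 - v' s))"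
  proof (intro integral_le_cont cont cth)
    fix s assume s: "s \<in> {-L..L}"
    have "v' s \<le> (v s)\<^sup>2 / 8 + A"
      using inner[OF s] outer[OF s] A_pos zero_le_power2[of "v s"] by linarith
    then have "w s * (h s)\<^sup>2 * (3 / 8 * (v s)\<^sup>2 - A) \<le> w s * (h s)\<^sup>2 * ((v s)\<^sup>2 / 2 - v' s)"
      by (intro mult_left_mono) auto
    then show "3 / 8 * (w s * (h s)\<^sup>2 * (v s)\<^sup>2) - A * (w s * (h s)\<^sup>2) \<le> w s * (h s)\<^sup>2 * ((v s)\<^sup>2 / 2 - v' s)"
      by (simp add: algebra_simps)
  qed auto
  also note by_parts[OF dh ch]
  finally show ?thesis by simp
qed

text \<open>R may exceed L, so the core is intersected with the interval.\<close>

definition R' :: real where "R' = min R L"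

lemma R': "0 < R'" "R' \<le> R" "R' \<le> L" using R_pos L_pos by (auto simp: R'_def)

text \<open>Off the core the weight in \<open>by_parts\<close> is at least 3/8, on the core at least
  - A. Only the mass on the core, where w is comparable to 1, is left to control.\<close>

lemma lyapunov_core:
  assumes dh: "\<And>s. s \<in> {-L..L} \<Longrightarrow> (h has_real_derivative h' s) (at s within {-L..L})"
    and ch: "continuous_on {-L..L} h'"
  shows "integral {-L..L} (\<lambda>s. w s * (h s)\<^sup>2) \<le> 8 * integral {-L..L} (\<lambda>s. w s * (h' s)\<^sup>2)
    + 4 * (A + 1) * integral {-R'..R'} (\<lambda>s. w s * (h s)\<^sup>2)"
proof -
  have cth: "continuous_on {-L..L} h" by (rule DERIV_continuous_on) (rule dh)
  let ?i = "\<lambda>s. if s \<in> {-R'..R'} then w s * (h s)\<^sup>2 else 0"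
  have eq: "{-L..L} \<inter> {-R'..R'} = {-R'..R'}" "{-R'..R'} \<inter> {-L..L} = {-R'..R'}" using R' by auto
  have cwh: "continuous_on {-L..L} (\<lambda>s. w s * (h s)\<^sup>2)" by (intro cont cth)
  have i: "?i integrable_on {-L..L}"
    unfolding integrable_restrict_Int eq using R'
    by (intro integrable_continuous_interval continuous_on_subset[OF cwh]) auto
  have j: "(\<lambda>s. w s * (h s)\<^sup>2 * ((v s)\<^sup>2 / 2 - v' s)) integrable_on {-L..L}"
    by (intro integrable_continuous_interval cont cth) auto
  have "integral {-L..L} (\<lambda>s. w s * (h s)\<^sup>2) \<le> integral {-L..L}
     (\<lambda>s. 4 * (w s * (h s)\<^sup>2 * ((v s)\<^sup>2 / 2 - v' s)) + 4 * (A + 1) * ?i s)"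
  proof (intro integral_le integrable_add integrable_on_mult_right i j)
    show "(\<lambda>s. w s * (h s)\<^sup>2) integrable_on {-L..L}"
      by (intro integrable_continuous_interval cont cth)
    fix s assume s: "s \<in> {-L..L}"
    show "w s * (h s)\<^sup>2 \<le> 4 * (w s * (h s)\<^sup>2 * ((v s)\<^sup>2 / 2 - v' s)) + 4 * (A + 1) * ?i s"
    proof (cases "s \<in> {-R'..R'}")
      case True
      then have "\<bar>s\<bar> \<le> R" using R' by auto
      then have "1 \<le> 4 * ((v s)\<^sup>2 / 2 - v' s) + 4 * (A + 1)"
        using inner[OF s] zero_le_power2[of "v s"] by argo
      then have "w s * (h s)\<^sup>2 * 1 \<le> w s * (h s)\<^sup>2 * (4 * ((v s)\<^sup>2 / 2 - v' s) + 4 * (A + 1))"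
        by (intro mult_left_mono) auto
      then show ?thesis using True by (simp add: algebra_simps)
    next
      case False
      then have "R \<le> \<bar>s\<bar>" using s unfolding R'_def by auto
      then have "1 \<le> 4 * ((v s)\<^sup>2 / 2 - v' s)"
        using outer[OF s] by argo
      then have "w s * (h s)\<^sup>2 * 1 \<le> w s * (h s)\<^sup>2 * (4 * ((v s)\<^sup>2 / 2 - v' s))"
        by (intro mult_left_mono) auto
      then show ?thesis using False by (auto simp add: algebra_simps)
    qed
  qed
  also have "\<dots> = 4 * integral {-L..L} (\<lambda>s. w s * (h s)\<^sup>2 * ((v s)\<^sup>2 / 2 - v' s))
      + 4 * (A + 1) * integral {-R'..R'} (\<lambda>s. w s * (h s)\<^sup>2)"
  proof -
    have "integral {-L..L} ?i = integral {-R'..R'} (\<lambda>s. w s * (h s)\<^sup>2)"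
      unfolding integral_restrict_Int eq ..
    then show ?thesis
      by (subst integral_add[OF integrable_on_mult_right[OF j] integrable_on_mult_right[OF i]])
        (simp only: integral_mult_right)
  qed
  finally show ?thesis using by_parts[OF dh ch] by linarith
qed

lemma core_w: "s \<in> {-R'..R'} \<Longrightarrow> w s \<le> exp A \<and> 1 \<le> exp A * w s"
proof -
  assume "s \<in> {-R'..R'}"
  then have "\<bar>V s\<bar> \<le> A" using R' inner[of s] by auto
  then have "- V s \<le> A" "V s \<le> A" by auto
  then show ?thesis by (simp add: w_def flip: exp_add)
qed

text \<open>\<open>lyapunov_core\<close> for the constant function 1, whose energy is 0; the bound
  does not see L.\<close>

lemma total_mass_le: "integral {-L..L} w \<le> 4 * (A + 1) * (2 * R * exp A)"
proof -
  have "integral {-L..L} w \<le> 4 * (A + 1) * integral {-R'..R'} w"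
    using lyapunov_core[of "\<lambda>_. 1" "\<lambda>_. 0"] by simp
  also have "integral {-R'..R'} w \<le> integral {-R'..R'} (\<lambda>_. exp A)"
    using core_w R' by (intro integral_le_cont continuous_on_subset[OF cont_w]) auto
  also have "\<dots> = 2 * R' * exp A" using R' by simp
  also have "\<dots> \<le> 2 * R * exp A" using R' by simp
  finally show ?thesis using A_pos by simp
qed

text \<open>On the core w is bounded above and below, so Cauchy-Schwarz controls the oscillation of
  h around h 0; \<open>lyapunov_core\<close> carries this to the whole interval. Centring at h 0
  suffices, since the mean is the optimal centre.\<close>

lemma poincare:
  assumes dh: "\<And>s. s \<in> {-L..L} \<Longrightarrow> (h has_real_derivative h' s) (at s within {-L..L})"
    and ch: "continuous_on {-L..L} h'"
  shows "integral {-L..L} (\<lambda>s. w s * (h s - h 0)\<^sup>2) \<le>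
    poincare_const A R * integral {-L..L} (\<lambda>s. w s * (h' s)\<^sup>2)"
proof -
  have cth: "continuous_on {-L..L} h" by (rule DERIV_continuous_on) (rule dh)
  define E where "E = integral {-L..L} (\<lambda>s. w s * (h' s)\<^sup>2)"
  have *: "(h d - h c)\<^sup>2 \<le> R * (exp A * E)" if cd: "c < d" "c \<in> {-R'..R'}" "d \<in> {-R'..R'}" "d - c \<le> R" for c d
  proof -
    have sub: "{c..d} \<subseteq> {-L..L}" "{c..d} \<subseteq> {-R'..R'}" using cd R' by auto
    have "(h d - h c)\<^sup>2 \<le> (d - c) * integral {c..d} (\<lambda>s. (h' s)\<^sup>2)"
      using sub cd by (intro increment_square_le continuous_on_subset[OF ch] DERIV_subset[OF dh]) auto
    also have "\<dots> \<le> R * integral {c..d} (\<lambda>s. (h' s)\<^sup>2)"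
      using cd by (intro mult_right_mono integral_nonneg integrable_continuous_interval
          continuous_intros continuous_on_subset[OF ch] sub) auto
    also have "integral {c..d} (\<lambda>s. (h' s)\<^sup>2) \<le> integral {c..d} (\<lambda>s. exp A * (w s * (h' s)\<^sup>2))"
    proof (intro integral_le_cont continuous_intros continuous_on_subset[OF ch] continuous_on_subset[OF cont_w] sub)
      fix s assume "s \<in> {c..d}"
      then have "1 * (h' s)\<^sup>2 \<le> (exp A * w s) * (h' s)\<^sup>2" using core_w[of s] sub by (intro mult_right_mono) auto
      then show "(h' s)\<^sup>2 \<le> exp A * (w s * (h' s)\<^sup>2)" by (simp add: mult.assoc)
    qed
    also have "\<dots> = exp A * integral {c..d} (\<lambda>s. w s * (h' s)\<^sup>2)" by simp
    also have "integral {c..d} (\<lambda>s. w s * (h' s)\<^sup>2) \<le> E"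
      unfolding E_def using cd R' by (intro integral_subinterval_le cont ch) auto
    finally show ?thesis using R_pos by simp
  qed
  have E0: "0 \<le> E" unfolding E_def by (intro integral_nonneg integrable_continuous_interval cont ch) auto
  have pt: "(h s - h 0)\<^sup>2 \<le> R * (exp A * E)" if "s \<in> {-R'..R'}" for s
  proof (cases s "0::real" rule: linorder_cases)
    case less
    then show ?thesis using *[of s 0] that R' by (simp add: power2_commute)
  next
    case equal
    then show ?thesis using E0 R_pos by simp
  next
    case greater
    then show ?thesis using *[of 0 s] that R' by simp
  qed
  have "integral {-R'..R'} (\<lambda>s. w s * (h s - h 0)\<^sup>2) \<le> integral {-R'..R'} (\<lambda>s. exp A * (R * (exp A * E)))"
  proof (rule integral_le_cont)
    have "continuous_on {-L..L} (\<lambda>s. w s * (h s - h 0)\<^sup>2)" by (intro cont cth)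
    then show "continuous_on {-R'..R'} (\<lambda>s. w s * (h s - h 0)\<^sup>2)"
      using R' by (elim continuous_on_subset) auto
    fix s assume "s \<in> {-R'..R'}"
    then show "w s * (h s - h 0)\<^sup>2 \<le> exp A * (R * (exp A * E))"
      using core_w pt by (intro mult_mono) auto
  qed simp
  also have "\<dots> = 2 * R' * (exp A * (R * (exp A * E)))" using R' by simp
  also have "\<dots> \<le> 2 * R * (exp A * (R * (exp A * E)))"
    using R' R_pos E0 by (intro mult_right_mono) auto
  finally have 1: "integral {-R'..R'} (\<lambda>s. w s * (h s - h 0)\<^sup>2) \<le> 2 * R * (exp A * (R * (exp A * E)))" .
  have dh': "((\<lambda>s. h s - h 0) has_real_derivative h' s) (at s within {-L..L})" if "s \<in> {-L..L}" for s
    using dh[OF that] by (auto intro!: derivative_eq_intros)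
  have "integral {-L..L} (\<lambda>s. w s * (h s - h 0)\<^sup>2) \<le> 8 * E + 4 * (A + 1) * (2 * R * (exp A * (R * (exp A * E))))"
  proof -
    have "4 * (A + 1) * integral {-R'..R'} (\<lambda>s. w s * (h s - h 0)\<^sup>2) \<le>
        4 * (A + 1) * (2 * R * (exp A * (R * (exp A * E))))"
      using A_pos by (intro mult_left_mono 1) auto
    moreover note lyapunov_core[OF dh' ch, folded E_def]
    ultimately show ?thesis by linarith
  qed
  then show ?thesis by (simp add: E_def poincare_const_def algebra_simps)
qed

text \<open>The derivative of w h^2 is w (2 h h' - h^2 v), and AM-GM bounds its integral by the
  bracketed sum. So w h^2 at s exceeds its value at any r by at most that sum; averaging over r
  costs a factor 1 / (2 L), which is at most A.\<close>

lemma sup_bound: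
  assumes dh: "\<And>s. s \<in> {-L..L} \<Longrightarrow> (h has_real_derivative h' s) (at s within {-L..L})"
    and ch: "continuous_on {-L..L} h'" and s: "s \<in> {-L..L}"
  shows "w s * (h s)\<^sup>2 \<le> A * integral {-L..L} (\<lambda>s. w s * (h s)\<^sup>2) +
    (integral {-L..L} (\<lambda>s. w s * (h' s)\<^sup>2) + 3 / 2 * integral {-L..L} (\<lambda>s. w s * (h s)\<^sup>2)
      + 1 / 2 * integral {-L..L} (\<lambda>s. w s * (h s)\<^sup>2 * (v s)\<^sup>2))" (is "_ \<le> A * ?M + ?Q")
proof -
  have cth: "continuous_on {-L..L} h" by (rule DERIV_continuous_on) (rule dh)
  let ?B = "\<lambda>s. w s * (h' s)\<^sup>2 + 3 / 2 * (w s * (h s)\<^sup>2) + 1 / 2 * (w s * (h s)\<^sup>2 * (v s)\<^sup>2)"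
  have B: "integral {-L..L} ?B = ?Q"
  proof -
    have i: "(\<lambda>s. w s * (h' s)\<^sup>2) integrable_on {-L..L}" "(\<lambda>s. w s * (h s)\<^sup>2) integrable_on {-L..L}"
      "(\<lambda>s. w s * (h s)\<^sup>2 * (v s)\<^sup>2) integrable_on {-L..L}"
      by (intro integrable_continuous_interval cont cth ch)+
    show ?thesis
      using i by (simp add: integral_add integrable_add integrable_on_mult_right)
  qed
  have kr: "w s * (h s)\<^sup>2 - w r * (h r)\<^sup>2 \<le> ?Q" if r: "r \<in> {-L..L}" for r
    unfolding B[symmetric]
  proof (rule increment_le_integral_bound[of "-L" L "\<lambda>s. w s * (h s)\<^sup>2" "\<lambda>s. w s * (2 * h s * h' s - (h s)\<^sup>2 * v s)"])
    fix x assume x: "x \<in> {-L..L}"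
    show "((\<lambda>s. w s * (h s)\<^sup>2) has_real_derivative w x * (2 * h x * h' x - (h x)\<^sup>2 * v x)) (at x within {-L..L})"
      by (rule derivative_eq_intros deriv_w dh refl x)+ (simp add: power2_eq_square algebra_simps)
    have "\<bar>2 * h x * h' x\<bar> \<le> (h x)\<^sup>2 + (h' x)\<^sup>2"
      using sum_squares_bound[of "\<bar>h x\<bar>" "\<bar>h' x\<bar>"] by (simp add: abs_mult)
    moreover have "\<bar>(h x)\<^sup>2 * v x\<bar> \<le> (h x)\<^sup>2 * (1 / 2 + 1 / 2 * (v x)\<^sup>2)"
      using sum_squares_bound[of "\<bar>v x\<bar>" 1] by (auto simp: abs_mult intro!: mult_left_mono)
    ultimately have "\<bar>2 * h x * h' x - (h x)\<^sup>2 * v x\<bar> \<le> (h' x)\<^sup>2 + 3 / 2 * (h x)\<^sup>2 + 1 / 2 * ((h x)\<^sup>2 * (v x)\<^sup>2)"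
      by (simp add: algebra_simps)
    then have "w x * \<bar>2 * h x * h' x - (h x)\<^sup>2 * v x\<bar> \<le> w x * ((h' x)\<^sup>2 + 3 / 2 * (h x)\<^sup>2 + 1 / 2 * ((h x)\<^sup>2 * (v x)\<^sup>2))"
      by (intro mult_left_mono) auto
    then show "\<bar>w x * (2 * h x * h' x - (h x)\<^sup>2 * v x)\<bar> \<le> ?B x"
      unfolding abs_mult by (simp add: algebra_simps)
  qed (use s r in \<open>auto intro!: cont cth ch\<close>)
  have "integral {-L..L} (\<lambda>r. w s * (h s)\<^sup>2) \<le> integral {-L..L} (\<lambda>r. w r * (h r)\<^sup>2 + ?Q)"
    using kr by (intro integral_le_cont cont cth) (auto simp: algebra_simps)
  also have "\<dots> = ?M + integral {-L..L} (\<lambda>r. ?Q)"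
    by (intro integral_add integrable_continuous_interval cont cth)
  finally have "2 * L * (w s * (h s)\<^sup>2) \<le> ?M + 2 * L * ?Q"
    using L_pos by (simp add: mult_ac)
  then have "w s * (h s)\<^sup>2 \<le> ?M / (2 * L) + ?Q"
    using L_pos by (simp add: field_simps)
  moreover have "?M / (2 * L) \<le> A * ?M"
  proof -
    have M0: "0 \<le> ?M" by (intro integral_nonneg integrable_continuous_interval cont cth) auto
    have "1 / (2 * L) \<le> A" using A_ge A_pos by simp
    then have "1 / (2 * L) * ?M \<le> A * ?M" using M0 by (intro mult_right_mono)
    then show ?thesis by simp
  qed
  ultimately show ?thesis by linarith
qed

text \<open>With h = G - c, \<open>ent_gap_square_le\<close> leaves the logarithm of h^2 / c^2.
  \<open>sup_bound\<close> gives h^2 \<le> exp V (A M + Q), and c^2 \<ge> M / (2 Z), so this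
  logarithm is at most V + Q / M up to a constant. Integrated against w h^2, the term V is paid by
  v^2 (hence by N), and Q / M contributes only Q.\<close>

theorem log_sobolev:
  assumes dG: "\<And>s. s \<in> {-L..L} \<Longrightarrow> (G has_real_derivative G' s) (at s within {-L..L})"
    and cG': "continuous_on {-L..L} G'" and Gpos: "\<And>s. s \<in> {-L..L} \<Longrightarrow> 0 < G s"
  obtains c where "0 < c"
    "integral {-L..L} (\<lambda>s. w s * ent_gap ((G s)\<^sup>2) c) \<le>
      log_sobolev_const A R * integral {-L..L} (\<lambda>s. w s * (G' s)\<^sup>2)"
proof -
  have cG: "continuous_on {-L..L} G" by (rule DERIV_continuous_on) (rule dG)
  define Z where "Z = integral {-L..L} w"
  define E where "E = integral {-L..L} (\<lambda>s. w s * (G' s)\<^sup>2)"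
  define I where "I = integral {-L..L} (\<lambda>s. w s * G s)"
  define P where "P = poincare_const A R"
  have Z: "0 < Z"
  proof -
    have "0 \<noteq> Z"
    proof
      assume "0 = Z"
      moreover have "(w has_integral Z) {-L..L}"
        unfolding Z_def by (intro integrable_integral integrable_continuous_interval cont)
      ultimately have "w 0 = 0"
        using L_pos by (intro has_integral_0_cbox_imp_0[of "-L" L w 0])
          (auto intro: cont_w simp: less_imp_le)
      then show False using w_pos[of 0] by simp
    qed
    moreover have "0 \<le> Z" unfolding Z_def by (intro integral_nonneg integrable_continuous_interval cont) auto
    ultimately show ?thesis by simp
  qed
  define S where "S = integral {-L..L} (\<lambda>s. w s * (G s)\<^sup>2)"
  have E0: "0 \<le> E" unfolding E_def by (intro integral_nonneg integrable_continuous_interval cont cG') auto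
  have I0: "0 \<le> I" unfolding I_def
    by (intro integral_nonneg integrable_continuous_interval cont cG mult_nonneg_nonneg w_nonneg
        less_imp_le[OF Gpos])
  have expand: "integral {-L..L} (\<lambda>s. w s * (G s - a)\<^sup>2) = S - 2 * a * I + a\<^sup>2 * Z" for a
  proof -
    have "((\<lambda>s. w s * (G s)\<^sup>2 - 2 * a * (w s * G s) + a\<^sup>2 * w s) has_integral (S - 2 * a * I + a\<^sup>2 * Z)) {-L..L}"
      unfolding S_def I_def Z_def
      by (intro has_integral_add has_integral_diff has_integral_mult_right integrable_integral
          integrable_continuous_interval cont cG)
    then show ?thesis
      by (intro integral_unique) (simp add: power2_eq_square algebra_simps)
  qed
  have S: "0 < S"
  proof -
    have "0 \<noteq> S"
    proof
      assume "0 = S"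
      moreover have "((\<lambda>s. w s * (G s)\<^sup>2) has_integral S) {-L..L}"
        unfolding S_def by (intro integrable_integral integrable_continuous_interval cont cG)
      ultimately have "w 0 * (G 0)\<^sup>2 = 0"
        using L_pos by (intro has_integral_0_cbox_imp_0[of "-L" L "\<lambda>s. w s * (G s)\<^sup>2" 0])
          (auto intro!: cont cG simp: less_imp_le)
      then show False using w_pos[of 0] Gpos[of 0] L_pos by simp
    qed
    moreover have "0 \<le> S" unfolding S_def by (intro integral_nonneg integrable_continuous_interval cont cG) auto
    ultimately show ?thesis by simp
  qed
  \<comment> \<open>Centring at the \<open>L\<^sup>2\<close>-norm rather than at the mean gives \<open>\<integral>w h\<^sup>2 \<le> 2 c\<^sup>2 Z\<close> for free,
    which replaces Rothaus' lemma.\<close>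
  define c where "c = sqrt (S / Z)"
  have c: "0 < c" and c2: "c\<^sup>2 * Z = S" using S Z by (auto simp: c_def)
  define h where "h s = G s - c" for s
  have dh: "(h has_real_derivative G' s) (at s within {-L..L})" if "s \<in> {-L..L}" for s
    unfolding h_def using dG[OF that] by (auto intro!: derivative_eq_intros)
  have ch: "continuous_on {-L..L} h" unfolding h_def by (intro continuous_intros cG)
  define M where "M = integral {-L..L} (\<lambda>s. w s * (h s)\<^sup>2)"
  define N where "N = integral {-L..L} (\<lambda>s. w s * (h s)\<^sup>2 * (v s)\<^sup>2)"
  define Q where "Q = E + 3 / 2 * M + 1 / 2 * N"
  have M0: "0 \<le> M" and N0: "0 \<le> N" unfolding M_def N_def
    by (intro integral_nonneg integrable_continuous_interval cont ch, auto)+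
  have Q0: "0 \<le> Q" using E0 M0 N0 by (simp add: Q_def)
  have Meq: "M = 2 * c * (c * Z - I)"
    unfolding M_def h_def expand c2[symmetric] by (simp add: power2_eq_square algebra_simps)
  have M2: "M \<le> 2 * c\<^sup>2 * Z"
    unfolding Meq using c I0 by (simp add: power2_eq_square algebra_simps)
  have MP: "M \<le> 2 * P * E"
  proof -
    have "S - 2 * G 0 * I + (G 0)\<^sup>2 * Z \<le> P * E"
      using poincare[OF dG cG'] unfolding expand P_def E_def .
    then have "Z * (S - 2 * G 0 * I + (G 0)\<^sup>2 * Z) \<le> Z * (P * E)" using Z by (intro mult_left_mono) auto
    \<comment> \<open>The first product is c^2 Z^2 - I^2 = Z S - I^2, the variance up to
      normalisation; the square is the cost of centring at G 0 and is dropped. Since Z M = 2 c Z (c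
      Z - I), replacing c Z by c Z + I then bounds M.\<close>
    moreover have "Z * (S - 2 * G 0 * I + (G 0)\<^sup>2 * Z) = (c * Z - I) * (c * Z + I) + (G 0 * Z - I)\<^sup>2"
      unfolding c2[symmetric] by (simp add: power2_eq_square algebra_simps)
    ultimately have 1: "(c * Z - I) * (c * Z + I) \<le> Z * (P * E)"
      using zero_le_power2[of "G 0 * Z - I"] by linarith
    have "0 \<le> c * Z - I" using M0 c unfolding Meq by (simp add: zero_le_mult_iff)
    then have "(c * Z - I) * (c * Z) \<le> (c * Z - I) * (c * Z + I)" using I0 by (intro mult_left_mono) auto
    with 1 have "Z * M \<le> Z * (2 * P * E)" unfolding Meq by (simp add: algebra_simps)
    then show ?thesis using Z by simp
  qed
  have N3: "N \<le> (6 + 6 * A * P) * E"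
  proof -
    have "3 * N \<le> 16 * E + 8 * A * M"
      using lyapunov_drift_weight[OF dh cG'] by (simp add: N_def E_def M_def)
    moreover have "A * M \<le> A * (2 * P * E)" using MP A_pos by (intro mult_left_mono) auto
    ultimately have "3 * N \<le> 18 * E + 9 * (A * (2 * P * E))"
      using E0 M0 A_pos mult_nonneg_nonneg[of A M] by linarith
    then show ?thesis by (simp add: algebra_simps)
  qed
  have pt: "w s * ent_gap ((G s)\<^sup>2) (c\<^sup>2) \<le>
      w s * (h s)\<^sup>2 * (8 + 8 * A + 8 * Z) + w s * (h s)\<^sup>2 * (v s)\<^sup>2 * (4 * A) + w s * (h s)\<^sup>2 * (4 * (Q / M))"
    if s: "s \<in> {-L..L}" for s
  proof -
    have VA: "V s \<le> A + A * (v s)\<^sup>2"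
      using inner[OF s] outer[OF s] A_pos by (smt (verit) zero_le_mult_iff zero_le_power2)
    have "ln ((h s)\<^sup>2 / c\<^sup>2) \<le> 2 * A + 2 * Z + A * (v s)\<^sup>2 + Q / M"
    proof (cases "h s = 0")
      \<comment> \<open>Here \<open>ln 0 = 0\<close>, and the right side is nonnegative even if M =
        0, where \<open>Q / M\<close> is 0.\<close>
      case True
      then show ?thesis using A_pos Z Q0 M0 by simp
    next
      case False
      have sb: "w s * (h s)\<^sup>2 \<le> A * M + Q"
        using sup_bound[OF dh cG' s] by (simp add: M_def Q_def N_def E_def)
      have "M \<noteq> 0"
      proof
        assume "M = 0"
        moreover have "((\<lambda>s. w s * (h s)\<^sup>2) has_integral M) {-L..L}"
          unfolding M_def by (intro integrable_integral integrable_continuous_interval cont ch)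
        ultimately have "w s * (h s)\<^sup>2 = 0"
          using L_pos s by (intro has_integral_0_cbox_imp_0[of "-L" L "\<lambda>s. w s * (h s)\<^sup>2" s])
            (auto intro!: cont ch simp: less_imp_le)
        then show False using False w_pos[of s] by simp
      qed
      then have Mp: "0 < M" using M0 by simp
      have "(h s)\<^sup>2 / c\<^sup>2 \<le> exp (V s) * (A * M + Q) / (M / (2 * Z))"
      proof (intro frac_le)
        have "exp (V s) * (w s * (h s)\<^sup>2) \<le> exp (V s) * (A * M + Q)"
          using sb by (intro mult_left_mono) auto
        then show "(h s)\<^sup>2 \<le> exp (V s) * (A * M + Q)" by (simp add: w_def exp_minus field_simps)
        show "M / (2 * Z) \<le> c\<^sup>2" using M2 Z by (simp add: field_simps)
        show "0 \<le> exp (V s) * (A * M + Q)" using A_pos M0 Q0 by simp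
      qed (use Mp Z in auto)
      also have "\<dots> = exp (V s) * (2 * Z) * (A + Q / M)"
        using Mp Z by (simp add: field_simps)
      finally have "ln ((h s)\<^sup>2 / c\<^sup>2) \<le> ln (exp (V s) * (2 * Z) * (A + Q / M))"
        using False c by (intro ln_mono) auto
      also have "\<dots> = V s + ln (2 * Z) + ln (A + Q / M)"
        using Z add_pos_nonneg[of A "Q / M"] A_pos Q0 Mp by (simp add: ln_mult)
      also have "\<dots> \<le> V s + 2 * Z + (A + Q / M)"
      proof -
        have "ln (2 * Z) \<le> 2 * Z" using Z ln_le_minus_one[of "2 * Z"] by simp
        moreover have "ln (A + Q / M) \<le> A + Q / M"
          using ln_le_minus_one[of "A + Q / M"] A_pos Q0 Mp by (simp add: add_pos_nonneg)
        ultimately show ?thesis by simp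
      qed
      finally show ?thesis using VA by simp
    qed
    moreover have "0 \<le> 2 * A + 2 * Z + A * (v s)\<^sup>2 + Q / M" using A_pos Z Q0 M0 by simp
    ultimately have "8 + 4 * max 0 (ln ((h s)\<^sup>2 / c\<^sup>2)) \<le> 8 + 4 * (2 * A + 2 * Z + A * (v s)\<^sup>2 + Q / M)"
      by simp
    then have "(h s)\<^sup>2 * (8 + 4 * max 0 (ln ((h s)\<^sup>2 / c\<^sup>2))) \<le> (h s)\<^sup>2 * (8 + 4 * (2 * A + 2 * Z + A * (v s)\<^sup>2 + Q / M))"
      by (intro mult_left_mono) auto
    then have "ent_gap ((G s)\<^sup>2) (c\<^sup>2) \<le> (h s)\<^sup>2 * (8 + 4 * (2 * A + 2 * Z + A * (v s)\<^sup>2 + Q / M))"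
      using ent_gap_square_le[OF Gpos[OF s] c] unfolding h_def by linarith
    then have "w s * ent_gap ((G s)\<^sup>2) (c\<^sup>2) \<le> w s * ((h s)\<^sup>2 * (8 + 4 * (2 * A + 2 * Z + A * (v s)\<^sup>2 + Q / M)))"
      by (intro mult_left_mono) auto
    then show ?thesis by (simp add: algebra_simps)
  qed
  have bnd: "((\<lambda>s. w s * (h s)\<^sup>2 * (8 + 8 * A + 8 * Z) + w s * (h s)\<^sup>2 * (v s)\<^sup>2 * (4 * A) + w s * (h s)\<^sup>2 * (4 * (Q / M)))
     has_integral (M * (8 + 8 * A + 8 * Z) + N * (4 * A) + M * (4 * (Q / M)))) {-L..L}"
    unfolding M_def N_def
    by (intro has_integral_add has_integral_mult_left integrable_integral integrable_continuous_interval cont ch)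
  have cent: "continuous_on {-L..L} (\<lambda>s. w s * ent_gap ((G s)\<^sup>2) (c\<^sup>2))"
    unfolding ent_gap_def using Gpos by (intro cont cG) fastforce+
  have "integral {-L..L} (\<lambda>s. w s * ent_gap ((G s)\<^sup>2) (c\<^sup>2)) \<le> M * (8 + 8 * A + 8 * Z) + N * (4 * A) + M * (4 * (Q / M))"
    using pt integrable_continuous_interval[OF cent] bnd
    by (intro has_integral_le[OF integrable_integral bnd]) auto
  \<comment> \<open>If M = 0 the last product vanishes, otherwise M cancels.\<close>
  also have "\<dots> \<le> M * (8 + 8 * A + 8 * Z) + N * (4 * A) + 4 * Q" using Q0 by (cases "M = 0") auto
  also have "\<dots> = M * (14 + 8 * A + 8 * Z) + (4 * A + 2) * N + 4 * E" by (simp add: Q_def algebra_simps)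
  also have "\<dots> \<le> (2 * P * E) * (14 + 8 * A + 8 * (4 * (A + 1) * (2 * R * exp A))) + (4 * A + 2) * ((6 + 6 * A * P) * E) + 4 * E"
    using MP M0 N0 E0 N3 A_pos Z total_mass_le order_trans[OF M0 MP] unfolding Z_def[symmetric]
    by (intro add_mono mult_mono mult_left_mono order_refl) auto
  also have "\<dots> = log_sobolev_const A R * E"
    by (simp add: log_sobolev_const_def P_def algebra_simps)
  finally show ?thesis using that[of "c\<^sup>2"] c unfolding E_def by simp
qed

end

section \<open>Bernoulli product measures\<close>

definition bern_weight :: "nat \<Rightarrow> real \<Rightarrow> (nat \<Rightarrow> nat) \<Rightarrow> real" where
  "bern_weight n p \<eta> = (\<Prod>x<n. if \<eta> x = 1 then p else 1 - p)"

definition bern_exp :: "nat \<Rightarrow> real \<Rightarrow> ((nat \<Rightarrow> nat) \<Rightarrow> real) \<Rightarrow> real" where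
  "bern_exp n p f = (\<Sum>\<eta>\<in>Omega n. bern_weight n p \<eta> * f \<eta>)"

text \<open>All flip rates are 1; the actual rates enter only at the end, through a uniform lower
  bound.\<close>

definition glauber_form :: "nat \<Rightarrow> real \<Rightarrow> ((nat \<Rightarrow> nat) \<Rightarrow> real) \<Rightarrow> real" where
  "glauber_form n p f = (\<Sum>x<n. bern_exp n p (\<lambda>\<eta>. (sqrt (f (flip x \<eta>)) - sqrt (f \<eta>))\<^sup>2))"

lemma Omega_values: "\<eta> \<in> Omega n \<Longrightarrow> x < n \<Longrightarrow> \<eta> x = 0 \<or> \<eta> x = 1"
  by (auto simp: Omega_def PiE_iff)

lemma sum_Omega_Suc:
  fixes F :: "(nat \<Rightarrow> nat) \<Rightarrow> real"
  shows "(\<Sum>\<eta>\<in>Omega (Suc n). F \<eta>) = (\<Sum>\<xi>\<in>Omega n. F (\<xi>(n := 1)) + F (\<xi>(n := 0)))"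
proof -
  have eq: "Omega (Suc n) = (\<lambda>(y, g). g(n := y)) ` ({0, 1} \<times> Omega n)"
    unfolding Omega_def lessThan_Suc PiE_insert_eq ..
  have "inj_on (\<lambda>(y, g). g(n := y)) ({0, 1} \<times> Omega n)"
    unfolding Omega_def by (rule inj_combinator) simp
  then have "(\<Sum>\<eta>\<in>Omega (Suc n). F \<eta>) = (\<Sum>(y, g)\<in>{0, 1} \<times> Omega n. F (g(n := y)))"
    unfolding eq by (subst sum.reindex) (auto intro: sum.cong)
  also have "\<dots> = (\<Sum>y\<in>{0, 1}. \<Sum>g\<in>Omega n. F (g(n := y)))"
    by (simp add: sum.cartesian_product)
  finally show ?thesis by (simp add: sum.distrib)
qed

lemma bern_weight_upd:
  "bern_weight (Suc n) p (\<xi>(n := b)) = bern_weight n p \<xi> * (if b = 1 then p else 1 - p)"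
proof -
  have "(\<Prod>x<n. if (\<xi>(n := b)) x = 1 then p else 1 - p) = (\<Prod>x<n. if \<xi> x = 1 then p else 1 - p)"
    by (intro prod.cong) auto
  then show ?thesis by (simp add: bern_weight_def)
qed

lemma bern_exp_Suc:
  "bern_exp (Suc n) p f = bern_exp n p (\<lambda>\<xi>. p * f (\<xi>(n := 1)) + (1 - p) * f (\<xi>(n := 0)))"
  unfolding bern_exp_def sum_Omega_Suc bern_weight_upd
  by (intro sum.cong) (auto simp: algebra_simps)

lemma bern_weight_pos: "0 < p \<Longrightarrow> p < 1 \<Longrightarrow> 0 < bern_weight n p \<eta>"
  by (auto simp: bern_weight_def intro!: prod_pos)

lemma bern_exp_mono:
  assumes "0 < p" "p < 1" "\<And>\<eta>. \<eta> \<in> Omega n \<Longrightarrow> f \<eta> \<le> g \<eta>"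
  shows "bern_exp n p f \<le> bern_exp n p g"
  unfolding bern_exp_def
  using assms bern_weight_pos[of p n] by (intro sum_mono mult_left_mono) (auto intro: less_imp_le)

lemma bern_exp_add: "bern_exp n p (\<lambda>\<eta>. f \<eta> + g \<eta>) = bern_exp n p f + bern_exp n p g"
  by (simp add: bern_exp_def sum.distrib algebra_simps)

lemma bern_exp_diff: "bern_exp n p (\<lambda>\<eta>. f \<eta> - g \<eta>) = bern_exp n p f - bern_exp n p g"
  by (simp add: bern_exp_def sum_subtractf algebra_simps)

lemma bern_exp_cmult: "bern_exp n p (\<lambda>\<eta>. c * f \<eta>) = c * bern_exp n p f"
  by (simp add: bern_exp_def sum_distrib_left algebra_simps)

lemma bern_exp_const: "bern_exp n p (\<lambda>\<eta>. c) = c"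
  by (induction n) (auto simp: bern_exp_Suc algebra_simps, simp add: bern_exp_def Omega_def bern_weight_def)

lemma bern_exp_cong: "(\<And>\<eta>. \<eta> \<in> Omega n \<Longrightarrow> f \<eta> = g \<eta>) \<Longrightarrow> bern_exp n p f = bern_exp n p g"
  by (simp add: bern_exp_def)

lemma bern_exp_nonneg:
  assumes "0 < p" "p < 1" "\<And>\<eta>. \<eta> \<in> Omega n \<Longrightarrow> 0 \<le> f \<eta>"
  shows "0 \<le> bern_exp n p f"
  using bern_exp_mono[of p n "\<lambda>_. 0" f] assms by (simp add: bern_exp_const)

section \<open>Entropy under a product measure: two-point inequality and tensorization\<close>

lemma two_point_entropy:
  fixes a b p :: real
  assumes p: "0 < p" "p < 1" and ab: "0 \<le> a" "0 \<le> b"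
  defines "m \<equiv> p * a + (1 - p) * b"
  shows "p * (a * ln a) + (1 - p) * (b * ln b) - m * ln m \<le> 2 * (sqrt a - sqrt b)\<^sup>2"
proof (cases "a = 0 \<and> b = 0")
  case True
  then show ?thesis by (simp add: m_def)
next
  case False
  have m0: "0 \<le> m" unfolding m_def using p ab by simp
  have "m \<noteq> 0"
  proof
    assume "m = 0"
    then have "p * a = 0" "(1 - p) * b = 0"
      using p ab unfolding m_def by (simp_all add: add_nonneg_eq_0_iff)
    then show False using p False by simp
  qed
  then have m: "0 < m" using m0 by simp
  \<comment> \<open>The tangent of ln at m bounds the entropy by variance over mean. The variance is
    p (1 - p) (a - b)^2, and both (a - b)^2 \<le> 2 (a + b) (sqrt a - sqrt b)^2 and p (1 - p) (a +
    b) \<le> m hold, so the final constant does not depend on p.\<close>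
  have l: "x * ln x \<le> x * ln m + x * (x / m - 1)" if "0 \<le> x" for x
  proof (cases "x = 0")
    case False
    then have x: "0 < x" using that by simp
    have "ln x - ln m \<le> x / m - 1" using ln_le_minus_one[of "x / m"] x m by (simp add: ln_div)
    then have "x * (ln x - ln m) \<le> x * (x / m - 1)" using x by (intro mult_left_mono) auto
    then show ?thesis by (simp add: algebra_simps)
  qed auto
  have "p * (a * ln a) + (1 - p) * (b * ln b) \<le>
      p * (a * ln m + a * (a / m - 1)) + (1 - p) * (b * ln m + b * (b / m - 1))"
    using p ab by (intro add_mono mult_left_mono l) auto
  also have "\<dots> = m * ln m + (p * a\<^sup>2 + (1 - p) * b\<^sup>2 - m * m) / m"
  proof -
    have l: "m * l = p * (a * l) + (1 - p) * (b * l)" for l by (simp add: m_def algebra_simps)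
    have "(p * a\<^sup>2 + (1 - p) * b\<^sup>2 - m * m) / m = p * (a * (a / m)) + (1 - p) * (b * (b / m)) - m"
      using m by (simp add: field_simps power2_eq_square)
    then show ?thesis unfolding l[of "ln m"] using l[of 1] by (simp add: algebra_simps)
  qed
  also have "p * a\<^sup>2 + (1 - p) * b\<^sup>2 - m * m = p * (1 - p) * (a - b)\<^sup>2"
    by (simp add: m_def power2_eq_square algebra_simps)
  also have "p * (1 - p) * (a - b)\<^sup>2 \<le> m * (2 * (sqrt a - sqrt b)\<^sup>2)"
  proof -
    have "a - b = (sqrt a - sqrt b) * (sqrt a + sqrt b)"
      using ab by (simp add: algebra_simps)
    then have "(a - b)\<^sup>2 = (sqrt a - sqrt b)\<^sup>2 * (sqrt a + sqrt b)\<^sup>2"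
      by (simp add: power_mult_distrib)
    also have "(sqrt a + sqrt b)\<^sup>2 \<le> 2 * (a + b)"
      using ab sum_squares_bound[of "sqrt a" "sqrt b"] by (simp add: power2_sum)
    finally have "(a - b)\<^sup>2 \<le> (sqrt a - sqrt b)\<^sup>2 * (2 * (a + b))" by (simp add: mult_left_mono)
    then have "p * (1 - p) * (a - b)\<^sup>2 \<le> p * (1 - p) * ((sqrt a - sqrt b)\<^sup>2 * (2 * (a + b)))"
      using p by (intro mult_left_mono) auto
    also have "\<dots> = (p * (1 - p) * (a + b)) * (2 * (sqrt a - sqrt b)\<^sup>2)" by (simp add: algebra_simps)
    also have "\<dots> \<le> m * (2 * (sqrt a - sqrt b)\<^sup>2)"
    proof (intro mult_right_mono)
      have "p * (1 - p) * a \<le> p * 1 * a" "p * (1 - p) * b \<le> 1 * (1 - p) * b"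
        using p ab by (intro mult_right_mono mult_left_mono; simp)+
      then show "p * (1 - p) * (a + b) \<le> m" by (simp add: m_def algebra_simps)
    qed simp
    finally show ?thesis .
  qed
  then have "p * (1 - p) * (a - b)\<^sup>2 / m \<le> 2 * (sqrt a - sqrt b)\<^sup>2"
    using m by (simp add: divide_le_eq mult.commute)
  finally show ?thesis by simp
qed

text \<open>The square root of the average is the L2(p) norm of (sqrt a, sqrt b), so this is the
  reverse triangle inequality. It shows that averaging out one spin does not increase the form at
  the other sites.\<close>

lemma sqrt_average_diff:
  fixes p :: real
  assumes p: "0 < p" "p < 1" and nn: "0 \<le> a" "0 \<le> b" "0 \<le> a'" "0 \<le> b'"
  shows "(sqrt (p * a + (1 - p) * b) - sqrt (p * a' + (1 - p) * b'))\<^sup>2 \<le>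
    p * (sqrt a - sqrt a')\<^sup>2 + (1 - p) * (sqrt b - sqrt b')\<^sup>2"
proof -
  define A B A' B' where "A = sqrt a" "B = sqrt b" "A' = sqrt a'" "B' = sqrt b'"
  have sq: "a = A\<^sup>2" "b = B\<^sup>2" "a' = A'\<^sup>2" "b' = B'\<^sup>2" and nn': "0 \<le> A" "0 \<le> B" "0 \<le> A'" "0 \<le> B'"
    using nn by (auto simp: A_B_A'_B'_def)
  define X Y where "X = p * A\<^sup>2 + (1 - p) * B\<^sup>2" and "Y = p * A'\<^sup>2 + (1 - p) * B'\<^sup>2"
  have X: "0 \<le> X" and Y: "0 \<le> Y" using p by (auto simp: X_def Y_def)
  have "X * Y - (p * A * A' + (1 - p) * B * B')\<^sup>2 = p * (1 - p) * (A * B' - A' * B)\<^sup>2"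
    by (simp add: X_def Y_def power2_eq_square algebra_simps)
  moreover have "0 \<le> p * (1 - p) * (A * B' - A' * B)\<^sup>2" using p by simp
  ultimately have "(p * A * A' + (1 - p) * B * B')\<^sup>2 \<le> X * Y" by linarith
  then have "p * A * A' + (1 - p) * B * B' \<le> sqrt X * sqrt Y"
    by (simp add: real_le_rsqrt flip: real_sqrt_mult)
  moreover have "(sqrt X - sqrt Y)\<^sup>2 = X + Y - 2 * (sqrt X * sqrt Y)"
    using X Y by (simp add: power2_diff)
  ultimately have "(sqrt X - sqrt Y)\<^sup>2 \<le> X + Y - 2 * (p * A * A' + (1 - p) * B * B')" by simp
  also have "\<dots> = p * (A - A')\<^sup>2 + (1 - p) * (B - B')\<^sup>2"
    by (simp add: X_def Y_def power2_eq_square algebra_simps)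
  finally show ?thesis unfolding X_def Y_def sq using nn' by simp
qed

text \<open>Induction on the sites by the chain rule: the entropy is the mean entropy in the last
  spin plus the entropy of the partial average m. The first is the two-point case; the induction
  hypothesis treats the second, and \<open>sqrt_average_diff\<close> returns from m to f.\<close>

lemma bernoulli_log_sobolev:
  assumes p: "0 < p" "p < 1" and f: "\<And>\<eta>. \<eta> \<in> Omega n \<Longrightarrow> 0 \<le> f \<eta>"
  shows "bern_exp n p (\<lambda>\<eta>. f \<eta> * ln (f \<eta>)) - bern_exp n p f * ln (bern_exp n p f) \<le> 2 * glauber_form n p f"
  using f
proof (induction n arbitrary: f)
  case 0
  then show ?case by (simp add: bern_exp_def Omega_def bern_weight_def glauber_form_def)
next
  case (Suc n)
  have up: "\<xi>(n := b) \<in> Omega (Suc n)" if "\<xi> \<in> Omega n" "b \<in> {0, 1}" for \<xi> b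
    using that by (auto simp: Omega_def PiE_iff extensional_def less_Suc_eq)
  have f0: "0 \<le> f (\<xi>(n := 0))" "0 \<le> f (\<xi>(n := 1))" if "\<xi> \<in> Omega n" for \<xi>
    using that up Suc.prems by auto
  define m where "m \<xi> = p * f (\<xi>(n := 1)) + (1 - p) * f (\<xi>(n := 0))" for \<xi>
  have m0: "0 \<le> m \<xi>" if "\<xi> \<in> Omega n" for \<xi> unfolding m_def using p f0[OF that] by simp
  have em: "bern_exp (Suc n) p f = bern_exp n p m"
    unfolding bern_exp_Suc by (intro bern_exp_cong) (simp add: m_def)
  let ?d = "\<lambda>\<xi>. (sqrt (f (\<xi>(n := 1))) - sqrt (f (\<xi>(n := 0))))\<^sup>2"
  have "bern_exp (Suc n) p (\<lambda>\<eta>. f \<eta> * ln (f \<eta>)) - bern_exp (Suc n) p f * ln (bern_exp (Suc n) p f) =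
      bern_exp n p (\<lambda>\<xi>. p * (f (\<xi>(n := 1)) * ln (f (\<xi>(n := 1)))) + (1 - p) * (f (\<xi>(n := 0)) * ln (f (\<xi>(n := 0)))) - m \<xi> * ln (m \<xi>))
      + (bern_exp n p (\<lambda>\<xi>. m \<xi> * ln (m \<xi>)) - bern_exp n p m * ln (bern_exp n p m))"
    unfolding em by (simp add: bern_exp_Suc bern_exp_diff)
  also have "\<dots> \<le> bern_exp n p (\<lambda>\<xi>. 2 * ?d \<xi>) + 2 * glauber_form n p m"
  proof (intro add_mono)
    show "bern_exp n p (\<lambda>\<xi>. p * (f (\<xi>(n := 1)) * ln (f (\<xi>(n := 1)))) + (1 - p) * (f (\<xi>(n := 0)) * ln (f (\<xi>(n := 0)))) - m \<xi> * ln (m \<xi>))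
       \<le> bern_exp n p (\<lambda>\<xi>. 2 * ?d \<xi>)"
      unfolding m_def by (intro bern_exp_mono p two_point_entropy f0)
    show "bern_exp n p (\<lambda>\<xi>. m \<xi> * ln (m \<xi>)) - bern_exp n p m * ln (bern_exp n p m) \<le> 2 * glauber_form n p m"
      by (rule Suc.IH) (rule m0)
  qed
  also have "bern_exp n p (\<lambda>\<xi>. 2 * ?d \<xi>) =
      2 * bern_exp (Suc n) p (\<lambda>\<eta>. (sqrt (f (flip n \<eta>)) - sqrt (f \<eta>))\<^sup>2)"
  proof -
    have "p * e + (1 - p) * e = e" for e :: real by (simp add: algebra_simps)
    then show ?thesis
      unfolding bern_exp_Suc bern_exp_cmult by (simp add: flip_def power2_commute)
  qed
  also have "glauber_form n p m \<le> (\<Sum>x<n. bern_exp (Suc n) p (\<lambda>\<eta>. (sqrt (f (flip x \<eta>)) - sqrt (f \<eta>))\<^sup>2))"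
    unfolding glauber_form_def
  proof (intro sum_mono)
    fix x assume x: "x \<in> {..<n}"
    have sw: "flip x (\<xi>(n := b)) = (flip x \<xi>)(n := b)" for \<xi> b
      using x by (auto simp: flip_def fun_eq_iff)
    show "bern_exp n p (\<lambda>\<eta>. (sqrt (m (flip x \<eta>)) - sqrt (m \<eta>))\<^sup>2)
        \<le> bern_exp (Suc n) p (\<lambda>\<eta>. (sqrt (f (flip x \<eta>)) - sqrt (f \<eta>))\<^sup>2)"
      unfolding bern_exp_Suc sw m_def
      using x by (intro bern_exp_mono p sqrt_average_diff f0 flip_in_Omega) auto
  qed
  finally show ?case by (simp add: glauber_form_def)
qed

section \<open>Derivative of Bernoulli expectations in the parameter\<close>

lemma bern_weight_deriv:
  assumes p: "0 < p" "p < 1" and \<eta>: "\<And>x. x < n \<Longrightarrow> \<eta> x = 0 \<or> \<eta> x = 1"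
  shows "((\<lambda>p. bern_weight n p \<eta>) has_real_derivative
    bern_weight n p \<eta> * ((\<Sum>x<n. real (\<eta> x) - p) / (p * (1 - p)))) (at p)"
  using \<eta>
proof (induction n)
  case 0
  then show ?case by (simp add: bern_weight_def)
next
  case (Suc n)
  have eq: "bern_weight (Suc n) q \<eta> = bern_weight n q \<eta> * (if \<eta> n = 1 then q else 1 - q)" for q
    by (simp add: bern_weight_def)
  \<comment> \<open>The logarithmic derivative is 1 / p for spin value 1 and - 1 / (1 - p) for 0;
    both equal (value - p) / (p (1 - p)).\<close>
  have d: "((\<lambda>q. if \<eta> n = 1 then q else 1 - q) has_real_derivative
      (if \<eta> n = 1 then p else 1 - p) * ((real (\<eta> n) - p) / (p * (1 - p)))) (at p)"
    using Suc.prems[of n] p by (auto intro!: derivative_eq_intros simp: field_simps)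
  show ?case
    unfolding eq
    by (rule DERIV_cong[OF DERIV_mult[OF Suc.IH d]]) (use Suc.prems in \<open>simp_all only: sum.lessThan_Suc add_divide_distrib distrib_left mult_ac add_ac less_SucI\<close>)
qed

lemma flip_flip: "\<eta> \<in> Omega n \<Longrightarrow> x < n \<Longrightarrow> flip x (flip x \<eta>) = \<eta>"
  using Omega_values[of \<eta> n x] by (auto simp: flip_def fun_eq_iff)

lemma sum_flip:
  fixes H :: "(nat \<Rightarrow> nat) \<Rightarrow> real"
  assumes x: "x < n"
  shows "(\<Sum>\<eta>\<in>Omega n. H (flip x \<eta>)) = (\<Sum>\<eta>\<in>Omega n. H \<eta>)"
  by (rule sum.reindex_bij_witness[of _ "flip x" "flip x"]) (use x in \<open>auto simp: flip_flip flip_in_Omega\<close>)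

lemma bern_weight_flip:
  assumes x: "x < n"
  shows "bern_weight n p (flip x \<eta>) * (if \<eta> x = 1 then p else 1 - p) =
    bern_weight n p \<eta> * (if flip x \<eta> x = 1 then p else 1 - p)"
proof -
  have s: "bern_weight n p \<zeta> = (if \<zeta> x = 1 then p else 1 - p) * (\<Prod>y\<in>{..<n} - {x}. if \<zeta> y = 1 then p else 1 - p)" for \<zeta>
    unfolding bern_weight_def using x by (subst prod.remove[of _ x]) auto
  have "(\<Prod>y\<in>{..<n} - {x}. if flip x \<eta> y = 1 then p else 1 - p) = (\<Prod>y\<in>{..<n} - {x}. if \<eta> y = 1 then p else 1 - p)"
    by (intro prod.cong) (auto simp: flip_def)
  then show ?thesis unfolding s[of "flip x \<eta>"] s[of \<eta>] by simp
qed

text \<open>Under a flip at x the weight times (\<eta> x - p) changes sign, so f may be replaced by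
  half of f - f o flip. Factor this difference as (sqrt f - sqrt f o flip)(sqrt f + sqrt f o flip)
  and apply Cauchy-Schwarz; the second factor costs 1 / \<delta>, because a flip changes the weight
  by at most that ratio.\<close>

lemma bern_gradient_site:
  assumes \<delta>: "0 < \<delta>" "\<delta> \<le> p" "p \<le> 1 - \<delta>" and x: "x < n"
    and f: "\<And>\<eta>. \<eta> \<in> Omega n \<Longrightarrow> 0 \<le> f \<eta>"
  shows "(bern_exp n p (\<lambda>\<eta>. (real (\<eta> x) - p) * f \<eta>))\<^sup>2 \<le>
    bern_exp n p f / \<delta> * bern_exp n p (\<lambda>\<eta>. (sqrt (f (flip x \<eta>)) - sqrt (f \<eta>))\<^sup>2)"
proof -
  have p: "0 < p" "p < 1" using \<delta> by auto
  have dh: "\<delta> \<le> 1" using \<delta> by linarith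
  let ?W = "bern_weight n p"
  have W: "0 < ?W \<eta>" for \<eta> using bern_weight_pos p by blast
  define a where "a = bern_exp n p (\<lambda>\<eta>. (real (\<eta> x) - p) * f \<eta>)"
  define F where "F = bern_exp n p f"
  have anti: "?W (flip x \<eta>) * (real (flip x \<eta> x) - p) = - (?W \<eta> * (real (\<eta> x) - p))" if "\<eta> \<in> Omega n" for \<eta>
    using Omega_values[OF that x] bern_weight_flip[OF x, of p \<eta>] by (auto simp: flip_def algebra_simps)
  have flipW: "?W (flip x \<eta>) \<le> ?W \<eta> / \<delta>" if "\<eta> \<in> Omega n" for \<eta>
  proof -
    have "?W (flip x \<eta>) * \<delta> \<le> ?W (flip x \<eta>) * (if \<eta> x = 1 then p else 1 - p)"
      using \<delta> W[of "flip x \<eta>"] by (intro mult_left_mono) auto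
    also have "\<dots> \<le> ?W \<eta> * 1"
      unfolding bern_weight_flip[OF x] using p W[of \<eta>] by (intro mult_left_mono) auto
    finally show ?thesis using \<delta> by (simp add: field_simps)
  qed
  have "a = (\<Sum>\<eta>\<in>Omega n. ?W (flip x \<eta>) * ((real (flip x \<eta> x) - p) * f (flip x \<eta>)))"
    unfolding a_def bern_exp_def by (rule sum_flip[OF x, symmetric])
  also have "\<dots> = (\<Sum>\<eta>\<in>Omega n. - (?W \<eta> * (real (\<eta> x) - p) * f (flip x \<eta>)))"
    using anti by (intro sum.cong) (auto simp flip: mult.assoc)
  finally have "2 * a = (\<Sum>\<eta>\<in>Omega n. ?W \<eta> * (real (\<eta> x) - p) * (f \<eta> - f (flip x \<eta>)))"
  proof -
    assume a2: "a = (\<Sum>\<eta>\<in>Omega n. - (?W \<eta> * (real (\<eta> x) - p) * f (flip x \<eta>)))"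
    have a1: "a = (\<Sum>\<eta>\<in>Omega n. ?W \<eta> * ((real (\<eta> x) - p) * f \<eta>))"
      by (simp add: a_def bern_exp_def)
    have "a + a = (\<Sum>\<eta>\<in>Omega n. ?W \<eta> * ((real (\<eta> x) - p) * f \<eta>))
        + (\<Sum>\<eta>\<in>Omega n. - (?W \<eta> * (real (\<eta> x) - p) * f (flip x \<eta>)))"
      by (rule arg_cong2[where f = plus, OF a1 a2])
    then show ?thesis unfolding sum.distrib[symmetric] mult_2 by (simp add: algebra_simps)
  qed
  then have "\<bar>2 * a\<bar> \<le> (\<Sum>\<eta>\<in>Omega n. \<bar>?W \<eta> * (real (\<eta> x) - p) * (f \<eta> - f (flip x \<eta>))\<bar>)"
    by (simp only: sum_abs)
  also have "\<dots> \<le> (\<Sum>\<eta>\<in>Omega n. (sqrt (?W \<eta>) * \<bar>sqrt (f (flip x \<eta>)) - sqrt (f \<eta>)\<bar>) *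
      (sqrt (?W \<eta>) * (sqrt (f (flip x \<eta>)) + sqrt (f \<eta>))))"
  proof (intro sum_mono)
    fix \<eta> assume \<eta>: "\<eta> \<in> Omega n"
    have f0: "0 \<le> f \<eta>" "0 \<le> f (flip x \<eta>)" using f \<eta> flip_in_Omega[OF \<eta> x] by auto
    have "\<bar>f \<eta> - f (flip x \<eta>)\<bar> = \<bar>sqrt (f (flip x \<eta>)) - sqrt (f \<eta>)\<bar> * \<bar>sqrt (f (flip x \<eta>)) + sqrt (f \<eta>)\<bar>"
      unfolding abs_mult[symmetric] using f0 by (subst abs_minus_commute) (simp add: algebra_simps)
    moreover have "\<bar>real (\<eta> x) - p\<bar> \<le> 1" using Omega_values[OF \<eta> x] p by auto
    ultimately have "?W \<eta> * \<bar>real (\<eta> x) - p\<bar> * \<bar>f \<eta> - f (flip x \<eta>)\<bar> \<le>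
       ?W \<eta> * 1 * (\<bar>sqrt (f (flip x \<eta>)) - sqrt (f \<eta>)\<bar> * \<bar>sqrt (f (flip x \<eta>)) + sqrt (f \<eta>)\<bar>)"
      using W[of \<eta>] by (intro mult_mono) auto
    also have "\<dots> = (sqrt (?W \<eta>) * sqrt (?W \<eta>)) * (\<bar>sqrt (f (flip x \<eta>)) - sqrt (f \<eta>)\<bar> * (sqrt (f (flip x \<eta>)) + sqrt (f \<eta>)))"
      using f0 W[of \<eta>] by simp
    finally show "\<bar>?W \<eta> * (real (\<eta> x) - p) * (f \<eta> - f (flip x \<eta>))\<bar> \<le> (sqrt (?W \<eta>) * \<bar>sqrt (f (flip x \<eta>)) - sqrt (f \<eta>)\<bar>) *
      (sqrt (?W \<eta>) * (sqrt (f (flip x \<eta>)) + sqrt (f \<eta>)))"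
      using W[of \<eta>] by (simp only: abs_mult mult_ac abs_of_pos)
  qed
  finally have "\<bar>2 * a\<bar>\<^sup>2 \<le> (\<Sum>\<eta>\<in>Omega n. (sqrt (?W \<eta>) * \<bar>sqrt (f (flip x \<eta>)) - sqrt (f \<eta>)\<bar>) *
      (sqrt (?W \<eta>) * (sqrt (f (flip x \<eta>)) + sqrt (f \<eta>))))\<^sup>2"
    by (intro power_mono) auto
  also have "\<dots> \<le> (\<Sum>\<eta>\<in>Omega n. (sqrt (?W \<eta>) * \<bar>sqrt (f (flip x \<eta>)) - sqrt (f \<eta>)\<bar>)\<^sup>2) *
      (\<Sum>\<eta>\<in>Omega n. (sqrt (?W \<eta>) * (sqrt (f (flip x \<eta>)) + sqrt (f \<eta>)))\<^sup>2)"
    by (rule Cauchy_Schwarz_ineq_sum)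
  also have "(\<Sum>\<eta>\<in>Omega n. (sqrt (?W \<eta>) * \<bar>sqrt (f (flip x \<eta>)) - sqrt (f \<eta>)\<bar>)\<^sup>2) =
      bern_exp n p (\<lambda>\<eta>. (sqrt (f (flip x \<eta>)) - sqrt (f \<eta>))\<^sup>2)"
    unfolding bern_exp_def power_mult_distrib using W by (simp add: less_imp_le)
  also have "(\<Sum>\<eta>\<in>Omega n. (sqrt (?W \<eta>) * (sqrt (f (flip x \<eta>)) + sqrt (f \<eta>)))\<^sup>2) \<le> 4 * (F / \<delta>)"
  proof -
    have "(\<Sum>\<eta>\<in>Omega n. (sqrt (?W \<eta>) * (sqrt (f (flip x \<eta>)) + sqrt (f \<eta>)))\<^sup>2) \<le>
        (\<Sum>\<eta>\<in>Omega n. 2 * (?W \<eta> * f (flip x \<eta>)) + 2 * (?W \<eta> * f \<eta>))"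
    proof (intro sum_mono)
      fix \<eta> assume \<eta>: "\<eta> \<in> Omega n"
      have f0: "0 \<le> f \<eta>" "0 \<le> f (flip x \<eta>)" using f \<eta> flip_in_Omega[OF \<eta> x] by auto
      have "(sqrt (f (flip x \<eta>)) + sqrt (f \<eta>))\<^sup>2 \<le> 2 * f (flip x \<eta>) + 2 * f \<eta>"
        using f0 sum_squares_bound[of "sqrt (f (flip x \<eta>))" "sqrt (f \<eta>)"] by (simp add: power2_sum)
      then have "?W \<eta> * (sqrt (f (flip x \<eta>)) + sqrt (f \<eta>))\<^sup>2 \<le> ?W \<eta> * (2 * f (flip x \<eta>) + 2 * f \<eta>)"
        using W[of \<eta>] by (intro mult_left_mono) auto
      then show "(sqrt (?W \<eta>) * (sqrt (f (flip x \<eta>)) + sqrt (f \<eta>)))\<^sup>2 \<le> 2 * (?W \<eta> * f (flip x \<eta>)) + 2 * (?W \<eta> * f \<eta>)"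
        unfolding power_mult_distrib using W[of \<eta>] by (simp add: algebra_simps)
    qed
    also have "\<dots> = 2 * (\<Sum>\<eta>\<in>Omega n. ?W \<eta> * f (flip x \<eta>)) + 2 * F"
      by (simp add: F_def bern_exp_def sum.distrib sum_distrib_left)
    also have "(\<Sum>\<eta>\<in>Omega n. ?W \<eta> * f (flip x \<eta>)) = (\<Sum>\<eta>\<in>Omega n. ?W (flip x \<eta>) * f \<eta>)"
      by (subst sum_flip[OF x, symmetric]) (auto intro!: sum.cong simp: flip_flip[OF _ x])
    also have "\<dots> \<le> (\<Sum>\<eta>\<in>Omega n. ?W \<eta> / \<delta> * f \<eta>)"
      using flipW f by (intro sum_mono mult_right_mono) auto
    also have "\<dots> = F / \<delta>" by (simp add: F_def bern_exp_def sum_divide_distrib)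
    also have "2 * F \<le> 2 * (F / \<delta>)"
    proof -
      have "0 \<le> F" unfolding F_def using p f by (intro bern_exp_nonneg) auto
      then have "F * \<delta> \<le> F * 1" using dh by (intro mult_left_mono) auto
      then show ?thesis using \<delta> by (simp add: field_simps)
    qed
    finally show ?thesis by simp
  qed
  finally have "4 * a\<^sup>2 \<le> bern_exp n p (\<lambda>\<eta>. (sqrt (f (flip x \<eta>)) - sqrt (f \<eta>))\<^sup>2) * (4 * (F / \<delta>))"
    by (simp add: power_mult_distrib mult_left_mono bern_exp_nonneg p)
  then show ?thesis unfolding a_def F_def by (simp add: mult_ac)
qed

lemma bern_exp_deriv:
  assumes p: "0 < p" "p < 1"
  shows "((\<lambda>p. bern_exp n p f) has_real_derivative
    (\<Sum>x<n. bern_exp n p (\<lambda>\<eta>. (real (\<eta> x) - p) * f \<eta>)) / (p * (1 - p))) (at p)"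
proof -
  have "((\<lambda>p. bern_exp n p f) has_real_derivative
     (\<Sum>\<eta>\<in>Omega n. bern_weight n p \<eta> * ((\<Sum>x<n. real (\<eta> x) - p) / (p * (1 - p))) * f \<eta>)) (at p)"
    unfolding bern_exp_def
    by (intro DERIV_sum DERIV_cmult_right bern_weight_deriv p Omega_values)
  also have "(\<Sum>\<eta>\<in>Omega n. bern_weight n p \<eta> * ((\<Sum>x<n. real (\<eta> x) - p) / (p * (1 - p))) * f \<eta>)
    = (\<Sum>\<eta>\<in>Omega n. \<Sum>x<n. bern_weight n p \<eta> * ((real (\<eta> x) - p) * f \<eta>)) / (p * (1 - p))"
    unfolding sum_divide_distrib
    by (intro sum.cong refl) (simp add: sum_distrib_left sum_distrib_right sum_divide_distrib mult_ac)
  also have "(\<Sum>\<eta>\<in>Omega n. \<Sum>x<n. bern_weight n p \<eta> * ((real (\<eta> x) - p) * f \<eta>)) =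
     (\<Sum>x<n. bern_exp n p (\<lambda>\<eta>. (real (\<eta> x) - p) * f \<eta>))"
    unfolding bern_exp_def by (rule sum.swap)
  finally show ?thesis .
qed

text \<open>Cauchy-Schwarz over the n sites produces the factor n. The power of \<delta> is one from
  each site estimate and two from p (1 - p) \<ge> \<delta> / 2.\<close>

lemma bern_gradient:
  assumes \<delta>: "0 < \<delta>" "\<delta> \<le> p" "p \<le> 1 - \<delta>"
    and f: "\<And>\<eta>. \<eta> \<in> Omega n \<Longrightarrow> 0 \<le> f \<eta>"
  shows "((\<Sum>x<n. bern_exp n p (\<lambda>\<eta>. (real (\<eta> x) - p) * f \<eta>)) / (p * (1 - p)))\<^sup>2 \<le>
    real n * 4 / \<delta> ^ 3 * bern_exp n p f * glauber_form n p f"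
proof -
  have p: "0 < p" "p < 1" using \<delta> by auto
  have F: "0 \<le> bern_exp n p f" using p f by (intro bern_exp_nonneg) auto
  have D: "0 \<le> glauber_form n p f" unfolding glauber_form_def using p by (intro sum_nonneg bern_exp_nonneg) auto
  let ?a = "\<lambda>x. bern_exp n p (\<lambda>\<eta>. (real (\<eta> x) - p) * f \<eta>)"
  have "(\<Sum>x<n. 1 * ?a x)\<^sup>2 \<le> (\<Sum>x<n. 1\<^sup>2) * (\<Sum>x<n. (?a x)\<^sup>2)"
    by (rule Cauchy_Schwarz_ineq_sum)
  also have "\<dots> \<le> real n * (\<Sum>x<n. bern_exp n p f / \<delta> * bern_exp n p (\<lambda>\<eta>. (sqrt (f (flip x \<eta>)) - sqrt (f \<eta>))\<^sup>2))"
  proof -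
    have "(\<Sum>x<n. (?a x)\<^sup>2) \<le> (\<Sum>x<n. bern_exp n p f / \<delta> * bern_exp n p (\<lambda>\<eta>. (sqrt (f (flip x \<eta>)) - sqrt (f \<eta>))\<^sup>2))"
      by (intro sum_mono bern_gradient_site \<delta> f) auto
    then show ?thesis by (intro mult_mono) (auto intro: sum_nonneg)
  qed
  also have "\<dots> = real n * (bern_exp n p f / \<delta> * glauber_form n p f)"
    by (simp add: glauber_form_def sum_distrib_left)
  finally have 1: "(\<Sum>x<n. ?a x)\<^sup>2 \<le> real n * (bern_exp n p f / \<delta> * glauber_form n p f)" by simp
  have pd: "\<delta> / 2 \<le> p * (1 - p)"
  proof (cases "p \<le> 1 / 2")
    case True
    then have "\<delta> * (1 / 2) \<le> p * (1 - p)" using \<delta> by (intro mult_mono) auto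
    then show ?thesis by simp
  next
    case False
    then have "(1 / 2) * \<delta> \<le> p * (1 - p)" using \<delta> by (intro mult_mono) auto
    then show ?thesis by simp
  qed
  have "(\<Sum>x<n. ?a x)\<^sup>2 / (p * (1 - p))\<^sup>2 \<le> real n * (bern_exp n p f / \<delta> * glauber_form n p f) / (\<delta> / 2)\<^sup>2"
    using 1 pd \<delta> F D by (intro frac_le power_mono mult_nonneg_nonneg) auto
  also have "\<dots> = real n * 4 / \<delta> ^ 3 * bern_exp n p f * glauber_form n p f"
    using \<delta> by (simp add: field_simps power2_eq_square power3_eq_cube)
  finally show ?thesis by (simp add: power_divide)
qed

section \<open>The mixing law\<close>

text \<open>The difference of the two sides is a relative entropy; each term dominates the Hellinger
  quantity (sqrt x - sqrt y)^2, which is at least (x - y)^2 / 8 as x and y are below 2. This is the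
  Gaussian decay used in Laplace's method.\<close>

lemma relative_log_upper:
  fixes t \<tau> :: real
  assumes t: "\<bar>t\<bar> < 1" and \<tau>: "\<bar>\<tau>\<bar> < 1"
  shows "(1 + \<tau>) * ln (1 + t) + (1 - \<tau>) * ln (1 - t) \<le>
    (1 + \<tau>) * ln (1 + \<tau>) + (1 - \<tau>) * ln (1 - \<tau>) - (t - \<tau>)\<^sup>2 / 4"
proof -
  have *: "x * ln y \<le> x * ln x + (y - x) - (y - x)\<^sup>2 / 8" if x: "0 < x" "x < 2" and y: "0 < y" "y < 2" for x y :: real
  proof -
    define a b where "a = sqrt x" and "b = sqrt y"
    have ab: "0 < a" "0 < b" "x = a\<^sup>2" "y = b\<^sup>2" using x y by (auto simp: a_def b_def)
    have "ln (b / a) \<le> b / a - 1" using ab by (intro ln_le_minus_one) auto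
    then have "2 * a\<^sup>2 * ln (b / a) \<le> 2 * a\<^sup>2 * (b / a - 1)" by (intro mult_left_mono) auto
    also have "\<dots> = (y - x) - (a - b)\<^sup>2" using ab by (simp add: power2_eq_square field_simps)
    finally have 1: "x * ln y \<le> x * ln x + (y - x) - (a - b)\<^sup>2"
      using ab by (simp add: ln_div ln_realpow algebra_simps)
    have "(a + b)\<^sup>2 \<le> 2 * (x + y)" using sum_squares_bound[of a b] ab by (simp add: power2_sum)
    then have "(a + b)\<^sup>2 \<le> 8" using x y by simp
    then have "(a - b)\<^sup>2 * (a + b)\<^sup>2 \<le> (a - b)\<^sup>2 * 8" by (intro mult_left_mono) auto
    moreover have "(a - b)\<^sup>2 * (a + b)\<^sup>2 = (y - x)\<^sup>2"
      unfolding ab(3,4) power_mult_distrib[symmetric] by (subst power2_commute) (simp add: power2_eq_square algebra_simps)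
    ultimately show ?thesis using 1 by simp
  qed
  have "(1 + \<tau>) * ln (1 + t) \<le> (1 + \<tau>) * ln (1 + \<tau>) + (t - \<tau>) - (t - \<tau>)\<^sup>2 / 8"
    using *[of "1 + \<tau>" "1 + t"] t \<tau> by (simp add: abs_less_iff)
  moreover have "(1 - \<tau>) * ln (1 - t) \<le> (1 - \<tau>) * ln (1 - \<tau>) + (\<tau> - t) - (t - \<tau>)\<^sup>2 / 8"
    using *[of "1 - \<tau>" "1 - t"] t \<tau> by (simp add: abs_less_iff power2_commute)
  ultimately show ?thesis by linarith
qed

text \<open>Relative entropy is at most the chi-square distance, which here sums to exactly the
  subtracted term.\<close>

lemma relative_log_lower:
  fixes t \<tau> :: real
  assumes t: "\<bar>t\<bar> < 1" and \<tau>: "\<bar>\<tau>\<bar> < 1"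
  shows "(1 + \<tau>) * ln (1 + \<tau>) + (1 - \<tau>) * ln (1 - \<tau>) - 2 * (t - \<tau>)\<^sup>2 / (1 - t\<^sup>2) \<le>
    (1 + \<tau>) * ln (1 + t) + (1 - \<tau>) * ln (1 - t)"
proof -
  have *: "x * ln x - x * (x - y) / y \<le> x * ln y" if x: "0 < x" and y: "0 < y" for x y :: real
  proof -
    have "ln (x / y) \<le> x / y - 1" using x y by (intro ln_le_minus_one) auto
    then have "x * (ln x - ln y) \<le> x * (x / y - 1)" using x y by (intro mult_left_mono) (auto simp: ln_div)
    then show ?thesis using y by (simp add: field_simps)
  qed
  have pos: "0 < 1 + t" "0 < 1 - t" using t by auto
  have "(1 + t) * (1 - t) = 1 - t\<^sup>2" by (simp add: power2_eq_square algebra_simps)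
  moreover have "(1 + \<tau>) * (\<tau> - t) / (1 + t) + (1 - \<tau>) * (t - \<tau>) / (1 - t) = 2 * (t - \<tau>)\<^sup>2 / ((1 + t) * (1 - t))"
    using pos by (simp add: divide_simps) (simp add: power2_eq_square algebra_simps)
  ultimately have "(1 + \<tau>) * (\<tau> - t) / (1 + t) + (1 - \<tau>) * (t - \<tau>) / (1 - t) = 2 * (t - \<tau>)\<^sup>2 / (1 - t\<^sup>2)"
    by simp
  moreover have "(1 + \<tau>) * ln (1 + \<tau>) - (1 + \<tau>) * (\<tau> - t) / (1 + t) \<le> (1 + \<tau>) * ln (1 + t)"
    using *[of "1 + \<tau>" "1 + t"] t \<tau> by (simp add: abs_less_iff)
  moreover have "(1 - \<tau>) * ln (1 - \<tau>) - (1 - \<tau>) * (t - \<tau>) / (1 - t) \<le> (1 - \<tau>) * ln (1 - t)"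
    using *[of "1 - \<tau>" "1 - t"] t \<tau> by (simp add: abs_less_iff)
  ultimately show ?thesis by linarith
qed

text \<open>The Bernoulli parameter \<open>exp u / (2 * cosh u)\<close> of external field \<open>u\<close>, written in \<open>t = tanh (u / 2)\<close>.\<close>

definition field_prob :: "real \<Rightarrow> real" where
  "field_prob t = (1 + t)\<^sup>2 / (2 * (1 + t\<^sup>2))"

lemma field_prob_compl: "1 - field_prob t = (1 - t)\<^sup>2 / (2 * (1 + t\<^sup>2))"
proof -
  have "0 < 1 + t\<^sup>2" by (simp add: add_pos_nonneg)
  then show ?thesis by (simp add: field_prob_def field_simps) (simp add: power2_eq_square algebra_simps)
qed

lemma field_prob_bounds:
  assumes t: "\<bar>t\<bar> \<le> T" "T < 1"
  shows "(1 - T)\<^sup>2 / 4 \<le> field_prob t" "field_prob t \<le> 1 - (1 - T)\<^sup>2 / 4"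
proof -
  have t2: "t\<^sup>2 \<le> 1" using t by (simp add: abs_square_le_1)
  have "(1 - T)\<^sup>2 / 4 \<le> y\<^sup>2 / (2 * (1 + t\<^sup>2))" if "1 - T \<le> y" for y
    using that t t2 by (intro frac_le power_mono) (auto simp: add_pos_nonneg)
  from this[of "1 + t"] this[of "1 - t"]
  have "(1 - T)\<^sup>2 / 4 \<le> field_prob t" "(1 - T)\<^sup>2 / 4 \<le> 1 - field_prob t"
    unfolding field_prob_compl unfolding field_prob_def using t by (auto simp only: abs_le_iff)
  then show "(1 - T)\<^sup>2 / 4 \<le> field_prob t" "field_prob t \<le> 1 - (1 - T)\<^sup>2 / 4" by linarith+
qed

lemma field_prob_deriv:
  "(field_prob has_real_derivative (1 - t\<^sup>2) / (1 + t\<^sup>2)\<^sup>2) (at t)"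
proof -
  have p: "0 < 1 + t\<^sup>2" by (simp add: add_pos_nonneg)
  show ?thesis
    unfolding field_prob_def
    by (rule derivative_eq_intros refl | use p in force)+
      (use p in \<open>simp add: divide_simps\<close>, simp add: power2_eq_square algebra_simps)
qed

text \<open>
  The cutoff leaves a margin above \<open>\<gamma> \<le> (1 + r) / 2\<close>, the range of the saddle point \<open>\<tau>\<close>, and its square is
  at least \<open>r\<close>, which makes \<open>V\<close> increase outwards at the endpoints for every \<open>n\<close>.
\<close>

definition field_cutoff :: "real \<Rightarrow> real" where "field_cutoff r = (3 + r) / 4"

definition linear_bound :: "real \<Rightarrow> real \<Rightarrow> real" where "linear_bound \<theta> r = 2 * \<bar>\<theta>\<bar> / (1 - r)"

definition cutoff_gap :: "real \<Rightarrow> real" where "cutoff_gap r = 1 - field_cutoff r ^ 4"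

text \<open>Chosen so that s^2 \<ge> 2 B beyond it, where the cubic part of v beats the part with b,
  and s^2 \<ge> 9 / D, where v^2 beats v'.\<close>

definition core_radius :: "real \<Rightarrow> real \<Rightarrow> real" where
  "core_radius \<theta> r = sqrt (2 * linear_bound \<theta> r + 9 / cutoff_gap r)"

text \<open>Rescaled length of a window next to the saddle point, times a lower bound for the
  integrand on it relative to its peak; see \<open>mixture_lower\<close>.\<close>

definition mixture_const :: "real \<Rightarrow> real" where
  "mixture_const r = (1 - r) / 4 * exp (- (4 / ((1 - r) * (1 - (field_cutoff r)\<^sup>2))))"

text \<open>The 40 is 28 + 12: on the core 28 s^2 + 24 B \<le> 28 R^2 + 12 R^2 in the bound on v',
  since 2 B \<le> R^2.\<close>

definition core_bound :: "real \<Rightarrow> real \<Rightarrow> real" where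
  "core_bound \<theta> r = 40 * core_radius \<theta> r ^ 4 / (cutoff_gap r)\<^sup>2"

text \<open>One r < 1 serves all admissible n, and it keeps \<open>gam\<close> between (1 - r) / 2
  and (1 + r) / 2. Every constant is expressed through \<theta> and r only.\<close>

locale curie_weiss =
  fixes \<theta> r :: real and n :: nat
  assumes n_pos: "0 < n" and r: "0 \<le> r" "r < 1" and \<theta>_le: "\<bar>\<theta>\<bar> \<le> r * sqrt (real n)"
begin

definition q :: real where "q = sqrt (sqrt (real n))"
definition b :: real where "b = \<theta> / gam \<theta> n"
abbreviation "T \<equiv> field_cutoff r"
abbreviation "L \<equiv> T * q"
abbreviation "D \<equiv> cutoff_gap r"
abbreviation "B \<equiv> linear_bound \<theta> r"
abbreviation "R \<equiv> core_radius \<theta> r"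
abbreviation "A \<equiv> core_bound \<theta> r"

text \<open>Since n / \<gamma> = 2 n + b sqrt n, exp (- V) is (1 + t^2)^n (1 - t^2)^(n / \<gamma> -
  n) at t = s / q; the first factor cancels the Bernoulli normalisation. To leading order V is s^4 +
  b s^2.\<close>

definition V :: "real \<Rightarrow> real" where
  "V s = - (q ^ 4) * ln (1 + (s / q)\<^sup>2) - (q ^ 4 + b * q\<^sup>2) * ln (1 - (s / q)\<^sup>2)"

definition v :: "real \<Rightarrow> real" where
  "v s = 2 * s * (2 * s\<^sup>2 + b * (1 + (s / q)\<^sup>2)) / (1 - (s / q) ^ 4)"

definition v' :: "real \<Rightarrow> real" where
  "v' s = (12 * s\<^sup>2 + 2 * b + 6 * b * (s / q)\<^sup>2) / (1 - (s / q) ^ 4)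
     + 8 * (s / q) ^ 4 * (2 * s\<^sup>2 + b * (1 + (s / q)\<^sup>2)) / (1 - (s / q) ^ 4)\<^sup>2"

lemma q: "1 \<le> q" "q\<^sup>2 = sqrt (real n)" "q ^ 4 = real n"
proof -
  show "1 \<le> q" using n_pos by (simp add: q_def)
  show q2: "q\<^sup>2 = sqrt (real n)" by (simp add: q_def)
  have "q ^ 4 = (q\<^sup>2)\<^sup>2" by simp
  then show "q ^ 4 = real n" unfolding q2 by simp
qed

lemma q_pos: "0 < q" using q(1) by linarith

lemma T: "3 / 4 \<le> T" "T < 1" "0 < T" using r by (auto simp: field_cutoff_def)

lemma gam_eq: "2 * gam \<theta> n = 1 - \<theta> / q\<^sup>2" by (simp add: gam_def q)

lemma gam: "(1 - r) / 2 \<le> gam \<theta> n" "gam \<theta> n \<le> (1 + r) / 2" "0 < gam \<theta> n" "gam \<theta> n < 1"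
proof -
  have "\<bar>\<theta> / q\<^sup>2\<bar> \<le> r"
    using \<theta>_le q_pos by (simp add: q(2)[symmetric] abs_divide divide_le_eq)
  then have "- r \<le> \<theta> / q\<^sup>2" "\<theta> / q\<^sup>2 \<le> r" by linarith+
  then show "(1 - r) / 2 \<le> gam \<theta> n" "gam \<theta> n \<le> (1 + r) / 2" "0 < gam \<theta> n" "gam \<theta> n < 1"
    using gam_eq r by auto
qed

lemma inverse_gam: "1 / gam \<theta> n = 2 + b / q\<^sup>2"
proof -
  have "b / q\<^sup>2 = (1 - 2 * gam \<theta> n) / gam \<theta> n" unfolding b_def gam_eq by simp
  then show ?thesis using gam by (simp add: diff_divide_distrib)
qed

lemma b_le: "\<bar>b\<bar> \<le> B"
proof -
  have "\<bar>\<theta>\<bar> / gam \<theta> n \<le> \<bar>\<theta>\<bar> / ((1 - r) / 2)"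
    using gam r by (intro divide_left_mono) auto
  then show ?thesis using gam by (simp add: b_def linear_bound_def abs_divide mult.commute)
qed

lemma B_nonneg: "0 \<le> B" using r by (simp add: linear_bound_def)

lemma D: "0 < D" "D \<le> 1"
proof -
  have "T ^ 4 < 1" using T by (simp add: power_less_one_iff)
  then show "0 < D" by (simp add: cutoff_gap_def)
  show "D \<le> 1" using T by (simp add: cutoff_gap_def)
qed

lemma R_pos: "0 < R" and R2_ge: "2 * B \<le> R\<^sup>2" "9 / D \<le> R\<^sup>2" "9 \<le> R\<^sup>2"
proof -
  have "9 \<le> 9 / D" using D by (simp add: le_divide_eq)
  then show "0 < R" "2 * B \<le> R\<^sup>2" "9 / D \<le> R\<^sup>2" "9 \<le> R\<^sup>2"
    unfolding core_radius_def using B_nonneg D by simp_all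
qed

section \<open>Bounds on the rescaled potential, uniform in n\<close>

context
  fixes s :: real
  assumes s: "s \<in> {-L..L}"
begin

lemma abs_rescaled_le: "\<bar>s / q\<bar> \<le> T"
  using s q_pos by (auto simp: abs_le_iff field_simps)

lemma rescaled_bounds: "(s / q) ^ 4 \<le> T ^ 4" "(s / q)\<^sup>2 \<le> T\<^sup>2" "(s / q)\<^sup>2 < 1" "D \<le> 1 - (s / q) ^ 4"
proof -
  have "\<bar>s / q\<bar> ^ 4 \<le> T ^ 4" by (intro power_mono abs_rescaled_le) auto
  then show a: "(s / q) ^ 4 \<le> T ^ 4" by (metis even_numeral power_even_abs)
  have "\<bar>s / q\<bar>\<^sup>2 \<le> T\<^sup>2" by (intro power_mono abs_rescaled_le) auto
  then show b: "(s / q)\<^sup>2 \<le> T\<^sup>2" unfolding power2_abs .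
  have "T\<^sup>2 < 1" using T by (simp add: power_less_one_iff)
  then show "(s / q)\<^sup>2 < 1" using b by linarith
  show "D \<le> 1 - (s / q) ^ 4" using a by (simp add: cutoff_gap_def)
qed

lemma one_minus_rescaled_pow4: "1 - (s / q) ^ 4 = (1 - (s / q)\<^sup>2) * (1 + (s / q)\<^sup>2)"
  by (simp add: algebra_simps flip: power_add)

lemma deriv_V: "(V has_real_derivative v s) (at s)"
proof -
  define t where "t = s / q"
  have st: "s = t * q" using q_pos by (simp add: t_def)
  have p: "0 < 1 - t\<^sup>2" "0 < 1 + t\<^sup>2" using rescaled_bounds(3) by (auto simp: t_def add_pos_nonneg)
  have "(V has_real_derivative
      - (q ^ 4) * (2 * t / q / (1 + t\<^sup>2)) - (q ^ 4 + b * q\<^sup>2) * (- (2 * t / q) / (1 - t\<^sup>2))) (at s)"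
    unfolding V_def t_def
    by (rule derivative_eq_intros refl | use p q_pos in \<open>simp add: t_def; fail\<close>)+
      (use q_pos p in \<open>simp add: t_def mult_ac\<close>)
  also have "- (q ^ 4) * (2 * t / q / (1 + t\<^sup>2)) - (q ^ 4 + b * q\<^sup>2) * (- (2 * t / q) / (1 - t\<^sup>2)) = v s"
  proof -
    have v: "v s = 2 * (t * q) * (2 * (t * q)\<^sup>2 + b * (1 + t\<^sup>2)) / ((1 - t\<^sup>2) * (1 + t\<^sup>2))"
      unfolding v_def one_minus_rescaled_pow4 using st by (simp flip: t_def)
    have "q ^ 4 = q * q * q * q" by (simp add: power4_eq_xxxx)
    then show ?thesis
      unfolding v using p q_pos by (simp add: divide_simps power2_eq_square) (simp add: algebra_simps)
  qed
  finally show ?thesis .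
qed

lemma deriv_v: "(v has_real_derivative v' s) (at s)"
proof -
  define t where "t = s / q"
  have st: "s = t * q" using q_pos by (simp add: t_def)
  have p: "0 < 1 - t ^ 4" using rescaled_bounds(4) D by (auto simp: t_def)
  have "(v has_real_derivative
      ((2 * (2 * s\<^sup>2 + b * (1 + t\<^sup>2)) + 2 * s * (4 * s + b * (2 * t / q))) * (1 - t ^ 4)
       - 2 * s * (2 * s\<^sup>2 + b * (1 + t\<^sup>2)) * (- (4 * t ^ 3 / q))) / ((1 - t ^ 4) * (1 - t ^ 4))) (at s)"
    unfolding v_def t_def
    by (rule derivative_eq_intros refl | use p q_pos in \<open>simp add: t_def; fail\<close>)+
  also have "((2 * (2 * s\<^sup>2 + b * (1 + t\<^sup>2)) + 2 * s * (4 * s + b * (2 * t / q))) * (1 - t ^ 4)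
       - 2 * s * (2 * s\<^sup>2 + b * (1 + t\<^sup>2)) * (- (4 * t ^ 3 / q))) / ((1 - t ^ 4) * (1 - t ^ 4)) = v' s"
  proof -
    have 1: "2 * s * (4 * s + b * (2 * t / q)) = 8 * s\<^sup>2 + 4 * b * t\<^sup>2"
      using q_pos by (simp add: st power2_eq_square field_simps)
    have 2: "2 * s * (2 * s\<^sup>2 + b * (1 + t\<^sup>2)) * (- (4 * t ^ 3 / q)) = - (8 * t ^ 4 * (2 * s\<^sup>2 + b * (1 + t\<^sup>2)))"
      using q_pos unfolding st by (simp add: power3_eq_cube power4_eq_xxxx)
    show ?thesis
    proof -
      define X M where "X = 1 - t ^ 4" and "M = 2 * s\<^sup>2 + b * (1 + t\<^sup>2)"
      have e1: "(N * X - - (8 * t ^ 4 * M)) / (X * X) = N / X + 8 * t ^ 4 * M / X\<^sup>2" for N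
        using p unfolding X_def[symmetric] by (simp add: add_divide_distrib power2_eq_square)
      have e2: "2 * M + (8 * s\<^sup>2 + 4 * b * t\<^sup>2) = 12 * s\<^sup>2 + 2 * b + 6 * b * t\<^sup>2"
        by (simp add: M_def algebra_simps)
      show ?thesis
        unfolding 1 2 unfolding v'_def t_def[symmetric] X_def[symmetric] M_def[symmetric]
        unfolding e2 e1 ..
    qed
  qed
  finally show ?thesis .
qed

lemma v'_le: "v' s \<le> (28 * s\<^sup>2 + 24 * B) / D\<^sup>2"
proof -
  define t where "t = s / q"
  have t: "t\<^sup>2 \<le> 1" "t ^ 4 \<le> 1" "D \<le> 1 - t ^ 4"
    using rescaled_bounds D by (auto simp: t_def)
  have bt: "b * t\<^sup>2 \<le> B" "b \<le> B"
  proof -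
    have "\<bar>b * t\<^sup>2\<bar> \<le> B * 1" unfolding abs_mult using b_le t by (intro mult_mono) auto
    then show "b * t\<^sup>2 \<le> B" by simp
    show "b \<le> B" using b_le by simp
  qed
  have "(12 * s\<^sup>2 + 2 * b + 6 * b * t\<^sup>2) / (1 - t ^ 4) \<le> (12 * s\<^sup>2 + 8 * B) / D\<^sup>2"
  proof (rule frac_le)
    have "D\<^sup>2 \<le> D" using D mult_left_mono[of D 1 D] by (simp add: power2_eq_square)
    then show "D\<^sup>2 \<le> 1 - t ^ 4" using t by linarith
  qed (use bt B_nonneg D in auto)
  moreover have "8 * t ^ 4 * (2 * s\<^sup>2 + b * (1 + t\<^sup>2)) / (1 - t ^ 4)\<^sup>2 \<le> 8 * (2 * s\<^sup>2 + 2 * B) / D\<^sup>2"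
  proof (rule frac_le)
    have "8 * t ^ 4 * (2 * s\<^sup>2 + b * (1 + t\<^sup>2)) \<le> 8 * t ^ 4 * (2 * s\<^sup>2 + 2 * B)"
      using bt by (intro mult_left_mono) (auto simp: algebra_simps)
    also have "\<dots> \<le> 8 * 1 * (2 * s\<^sup>2 + 2 * B)"
      using t B_nonneg by (intro mult_right_mono mult_left_mono) auto
    finally show "8 * t ^ 4 * (2 * s\<^sup>2 + b * (1 + t\<^sup>2)) \<le> 8 * (2 * s\<^sup>2 + 2 * B)" by simp
    show "D\<^sup>2 \<le> (1 - t ^ 4)\<^sup>2" using t D by (intro power_mono) auto
  qed (use B_nonneg D in auto)
  ultimately have "v' s \<le> (12 * s\<^sup>2 + 8 * B) / D\<^sup>2 + 8 * (2 * s\<^sup>2 + 2 * B) / D\<^sup>2"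
    unfolding v'_def t_def[symmetric] by linarith
  also have "\<dots> = (28 * s\<^sup>2 + 24 * B) / D\<^sup>2" by (simp add: add_divide_distrib[symmetric])
  finally show ?thesis .
qed

text \<open>The two logarithms must be merged first: V = - q^4 ln (1 - t^4) - b q^2 ln (1 - t^2).
  Separately they are of order q^4 t^2 = q^2 s^2, which is unbounded in n; this cancellation makes
  the point critical.\<close>

lemma V_abs_le: "\<bar>V s\<bar> \<le> s ^ 4 / D + 2 * B * s\<^sup>2 / D"
proof -
  define t where "t = s / q"
  have st: "s = t * q" using q_pos by (simp add: t_def)
  have t: "0 < 1 - t\<^sup>2" "0 < 1 + t\<^sup>2" "D \<le> 1 - t ^ 4" "t\<^sup>2 < 1"
    using rescaled_bounds by (auto simp: t_def add_pos_nonneg)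
  have t4: "1 - t ^ 4 = (1 - t\<^sup>2) * (1 + t\<^sup>2)" unfolding t_def by (rule one_minus_rescaled_pow4)
  have VV: "V s = - (q ^ 4) * ln (1 - t ^ 4) - b * q\<^sup>2 * ln (1 - t\<^sup>2)"
  proof -
    have "ln (1 - t ^ 4) = ln (1 - t\<^sup>2) + ln (1 + t\<^sup>2)" unfolding t4 using t by (intro ln_mult_pos)
    then show ?thesis unfolding V_def t_def[symmetric] by (simp add: algebra_simps)
  qed
  have l: "\<bar>ln (1 - x)\<bar> \<le> x / d" if "0 \<le> x" "0 < d" "d \<le> 1 - x" for x d :: real
  proof -
    have "ln (1 / (1 - x)) \<le> 1 / (1 - x) - 1" using that by (intro ln_le_minus_one) auto
    then have "- ln (1 - x) \<le> x / (1 - x)" using that by (simp add: ln_div field_simps)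
    also have "\<dots> \<le> x / d" using that by (intro divide_left_mono) auto
    finally have "- ln (1 - x) \<le> x / d" .
    moreover have "ln (1 - x) \<le> 0" using that by (intro ln_le_zero_iff[THEN iffD2]) auto
    ultimately show ?thesis by simp
  qed
  have D2: "D / 2 \<le> 1 - t\<^sup>2"
  proof -
    have "(1 - t\<^sup>2) * (1 + t\<^sup>2) \<le> (1 - t\<^sup>2) * 2" using t by (intro mult_left_mono) auto
    then show ?thesis using t(3) t4 by simp
  qed
  have "\<bar>V s\<bar> \<le> q ^ 4 * \<bar>ln (1 - t ^ 4)\<bar> + \<bar>b\<bar> * q\<^sup>2 * \<bar>ln (1 - t\<^sup>2)\<bar>"
    unfolding VV by (rule order_trans[OF abs_triangle_ineq4]) (simp add: abs_mult)
  also have "\<dots> \<le> q ^ 4 * (t ^ 4 / D) + B * q\<^sup>2 * (t\<^sup>2 / (D / 2))"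
    using b_le l[of "t ^ 4" D] l[of "t\<^sup>2" "D / 2"] D D2 t
    by (intro add_mono mult_mono) auto
  also have "\<dots> = s ^ 4 / D + 2 * B * s\<^sup>2 / D"
    by (simp add: st power_mult_distrib mult_ac)
  finally show ?thesis .
qed

text \<open>Beyond the core radius the part with b is at most 2 B \<le> s^2, so half of the cubic
  force survives; the denominator of v only helps.\<close>

lemma v_sq_ge:
  assumes "R \<le> \<bar>s\<bar>"
  shows "4 * s ^ 6 \<le> (v s)\<^sup>2" "R\<^sup>2 \<le> s\<^sup>2"
proof -
  define t where "t = s / q"
  have t: "t\<^sup>2 \<le> 1" "0 < 1 - t ^ 4" "1 - t ^ 4 \<le> 1"
    using rescaled_bounds D by (auto simp: t_def)
  have "R\<^sup>2 \<le> \<bar>s\<bar>\<^sup>2" using assms R_pos by (intro power_mono) auto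
  then show Rs: "R\<^sup>2 \<le> s\<^sup>2" by simp
  have "\<bar>b * (1 + t\<^sup>2)\<bar> \<le> B * 2" unfolding abs_mult using b_le t by (intro mult_mono) auto
  then have 1: "s\<^sup>2 \<le> 2 * s\<^sup>2 + b * (1 + t\<^sup>2)" using Rs R2_ge(1) by linarith
  then have "(s\<^sup>2)\<^sup>2 \<le> (2 * s\<^sup>2 + b * (1 + t\<^sup>2))\<^sup>2" by (intro power_mono) auto
  then have "4 * s\<^sup>2 * (s\<^sup>2)\<^sup>2 \<le> 4 * s\<^sup>2 * (2 * s\<^sup>2 + b * (1 + t\<^sup>2))\<^sup>2" by (intro mult_left_mono) auto
  also have "\<dots> \<le> 4 * s\<^sup>2 * (2 * s\<^sup>2 + b * (1 + t\<^sup>2))\<^sup>2 / (1 - t ^ 4)\<^sup>2"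
  proof -
    have le1: "(1 - t ^ 4)\<^sup>2 \<le> 1" using t by (simp add: power_le_one)
    have "X \<le> X / (1 - t ^ 4)\<^sup>2" if "0 \<le> X" for X
      using t le1 that by (simp add: le_divide_eq mult_left_le)
    then show ?thesis by simp
  qed
  also have "\<dots> = (v s)\<^sup>2" by (simp add: v_def t_def power_mult_distrib power_divide)
  finally show "4 * s ^ 6 \<le> (v s)\<^sup>2" by (simp add: mult.assoc flip: power_add power_mult)
qed

lemma inner_bound:
  assumes "\<bar>s\<bar> \<le> R"
  shows "\<bar>V s\<bar> \<le> A \<and> v' s \<le> A"
proof -
  have "\<bar>s\<bar>\<^sup>2 \<le> R\<^sup>2" "\<bar>s\<bar> ^ 4 \<le> R ^ 4" using assms by (intro power_mono; simp)+
  then have s2: "s\<^sup>2 \<le> R\<^sup>2" "s ^ 4 \<le> R ^ 4" by simp_all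
  have R24: "R\<^sup>2 \<le> R ^ 4" using R2_ge mult_left_mono[of 1 "R\<^sup>2" "R\<^sup>2"] by (simp flip: power_add)
  have D2: "D\<^sup>2 \<le> D" using D mult_left_mono[of D 1 D] by (simp add: power2_eq_square)
  have "2 * B * s\<^sup>2 \<le> R\<^sup>2 * R\<^sup>2" using R2_ge s2 B_nonneg by (intro mult_mono) auto
  then have "2 * B * s\<^sup>2 \<le> R ^ 4" by (simp flip: power_add)
  moreover have "0 \<le> R ^ 4" by simp
  ultimately have "s ^ 4 + 2 * B * s\<^sup>2 \<le> 40 * R ^ 4" using s2 by linarith
  then have "(s ^ 4 + 2 * B * s\<^sup>2) / D \<le> 40 * R ^ 4 / D\<^sup>2"
    using D D2 B_nonneg by (intro frac_le) auto
  then have "\<bar>V s\<bar> \<le> A" using V_abs_le unfolding core_bound_def by (simp add: add_divide_distrib)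
  moreover have "(28 * s\<^sup>2 + 24 * B) / D\<^sup>2 \<le> 40 * R ^ 4 / D\<^sup>2"
  proof (rule divide_right_mono)
    show "28 * s\<^sup>2 + 24 * B \<le> 40 * R ^ 4" using s2 R24 R2_ge by linarith
  qed simp
  ultimately show ?thesis using v'_le unfolding core_bound_def by linarith
qed

lemma outer_bound:
  assumes "R \<le> \<bar>s\<bar>"
  shows "V s \<le> A * (v s)\<^sup>2 \<and> 1 \<le> (v s)\<^sup>2 \<and> v' s \<le> (v s)\<^sup>2 / 8"
proof -
  note v6 = v_sq_ge[OF assms]
  define x where "x = s\<^sup>2"
  have x: "9 \<le> x" "2 * B \<le> x" "9 / D \<le> x" using v6 R2_ge by (auto simp: x_def)
  have s4: "s ^ 4 = x * x" "s ^ 6 = x * x * x" by (simp_all add: x_def flip: power_add)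
  have x1: "x * 1 \<le> x * x" using x by (intro mult_left_mono) auto
  have x2: "(x * x) * 1 \<le> (x * x) * x" using x by (intro mult_left_mono) auto
  have vv: "4 * (x * x * x) \<le> (v s)\<^sup>2" using v6 s4 by simp
  have "1 \<le> (v s)\<^sup>2" using vv x1 x2 x by linarith
  moreover have "v' s \<le> (v s)\<^sup>2 / 8"
  proof -
    \<comment> \<open>The margin 81 \<ge> 80 is what turns 40 x / D^2 into at most x^3 / 2, the
      available eighth of v^2.\<close>
    have "(9 / D)\<^sup>2 \<le> x\<^sup>2" using x D by (intro power_mono) auto
    then have "81 \<le> x\<^sup>2 * D\<^sup>2" using D by (simp add: power_divide divide_le_eq)
    then have "80 * x \<le> (x\<^sup>2 * D\<^sup>2) * x" using x by (intro mult_right_mono) auto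
    then have "40 * x / D\<^sup>2 \<le> x * x * x / 2" using D by (simp add: divide_le_eq power2_eq_square algebra_simps)
    moreover have "(28 * x + 24 * B) / D\<^sup>2 \<le> 40 * x / D\<^sup>2" using x by (intro divide_right_mono) auto
    ultimately show ?thesis using v'_le vv unfolding x_def[symmetric] by linarith
  qed
  moreover have "V s \<le> A * (v s)\<^sup>2"
  proof -
    have R4: "1 \<le> R ^ 4"
      using R2_ge power_mono[of 1 "R\<^sup>2" 2] by (simp flip: power_mult)
    have A1: "2 / D \<le> A"
      unfolding core_bound_def
    proof (rule frac_le)
      show "D\<^sup>2 \<le> D" using D mult_left_mono[of D 1 D] by (simp add: power2_eq_square)
    qed (use D R4 in auto)
    have "V s \<le> x * x / D + 2 * B * x / D" using V_abs_le unfolding s4 x_def[symmetric] by linarith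
    also have "2 * B * x / D \<le> x * x / D" using x D by (intro divide_right_mono mult_right_mono) auto
    also have "x * x / D + x * x / D = 2 / D * (x * x)" by simp
    also have "\<dots> \<le> A * (v s)\<^sup>2"
    proof (rule mult_mono[OF A1])
      show "x * x \<le> (v s)\<^sup>2" using x1 x2 vv x by linarith
      show "0 \<le> A" using order_trans[OF _ A1, of 0] D by simp
    qed (use x in simp)
    finally show ?thesis by simp
  qed
  ultimately show ?thesis by simp
qed

end

lemma L_pos: "0 < L" using T q_pos by simp

text \<open>Multiplying the bracket by \<gamma> collapses it to T^2 sqrt n + \<theta>, which is
  nonnegative because T^2 \<ge> r. For \<theta> \<ge> 0 the bracket is visibly nonnegative.\<close>

lemma v_boundary: "0 \<le> v L"
proof -
  have "0 \<le> 2 * T\<^sup>2 * q\<^sup>2 + b * (1 + T\<^sup>2)"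
  proof (cases "0 \<le> \<theta>")
    case True
    then have "0 \<le> b" using gam by (simp add: b_def)
    then show ?thesis by simp
  next
    case False
    have "r \<le> ((1 + r) / 2)\<^sup>2" using zero_le_power2[of "1 - r"] by (simp add: power2_eq_square field_simps)
    also have "\<dots> \<le> T\<^sup>2" using r unfolding field_cutoff_def by (intro power_mono) auto
    finally have "r * q\<^sup>2 \<le> T\<^sup>2 * q\<^sup>2" by (intro mult_right_mono) auto
    then have 1: "- \<theta> \<le> T\<^sup>2 * q\<^sup>2" using \<theta>_le q(2) by simp
    have g2: "2 * gam \<theta> n * q\<^sup>2 = q\<^sup>2 - \<theta>" using gam_eq q_pos by (simp add: field_simps)
    have "gam \<theta> n * (2 * T\<^sup>2 * q\<^sup>2 + b * (1 + T\<^sup>2)) = T\<^sup>2 * (2 * gam \<theta> n * q\<^sup>2) + \<theta> * (1 + T\<^sup>2)"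
      using gam by (simp add: b_def algebra_simps)
    also have "\<dots> = T\<^sup>2 * q\<^sup>2 + \<theta>" unfolding g2 by (simp add: algebra_simps)
    finally have "0 \<le> gam \<theta> n * (2 * T\<^sup>2 * q\<^sup>2 + b * (1 + T\<^sup>2))" using 1 by simp
    then show ?thesis using gam by (simp add: zero_le_mult_iff)
  qed
  moreover have "v L = 2 * L * (2 * T\<^sup>2 * q\<^sup>2 + b * (1 + T\<^sup>2)) / (1 - T ^ 4)"
    using q_pos by (simp add: v_def power_mult_distrib)
  moreover have "0 \<le> 1 - T ^ 4" using D unfolding cutoff_gap_def by simp
  ultimately show ?thesis using L_pos by simp
qed

lemma v_odd: "v (- s) = - v s"
  by (simp add: v_def)

sublocale conf: confining_potential V v v' L R A
proof
  show "1 / L \<le> A"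
  proof -
    have "3 / 4 * 1 \<le> L" using T q by (intro mult_mono) auto
    then have "1 / L \<le> 40" by (simp add: divide_le_eq)
    also have "40 \<le> A"
    proof -
      have "1 \<le> R ^ 4" using R2_ge power_mono[of 1 "R\<^sup>2" 2] by (simp flip: power_mult)
      moreover have "D\<^sup>2 \<le> 1" using D by (simp add: power_le_one)
      ultimately show ?thesis unfolding core_bound_def using D by (simp add: le_divide_eq)
    qed
    finally show ?thesis .
  qed
  show "continuous_on {-L..L} v'"
    unfolding v'_def using rescaled_bounds(4) D q_pos
    by (intro continuous_intros) force+
  show "v (- L) \<le> 0" using v_boundary v_odd[of L] by simp
qed (use L_pos R_pos v_boundary inner_bound outer_bound in
      \<open>auto intro: has_field_derivative_at_within[OF deriv_V] has_field_derivative_at_within[OF deriv_v]\<close>)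

section \<open>Laplace comparison of the Bernoulli mixture with \<open>nu_U\<close>\<close>

definition mag :: "(nat \<Rightarrow> nat) \<Rightarrow> real" where "mag \<eta> = (\<Sum>x<n. spin \<eta> x)"

definition \<tau> :: "(nat \<Rightarrow> nat) \<Rightarrow> real" where "\<tau> \<eta> = gam \<theta> n * mag \<eta> / real n"

definition tilted_log :: "real \<Rightarrow> real \<Rightarrow> real" where
  "tilted_log m t = (1 + m) * ln (1 + t) + (1 - m) * ln (1 - t)"

definition mixture :: "(nat \<Rightarrow> nat) \<Rightarrow> real" where
  "mixture \<eta> = integral {-L..L} (\<lambda>s. conf.w s * bern_weight n (field_prob (s / q)) \<eta>)"

lemma spin_cases: "\<eta> \<in> Omega n \<Longrightarrow> x < n \<Longrightarrow> spin \<eta> x = 1 \<or> spin \<eta> x = - 1"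
  using Omega_values[of \<eta> n x] by (auto simp: spin_def)

lemma tau_bound: assumes "\<eta> \<in> Omega n" shows "\<bar>\<tau> \<eta>\<bar> \<le> gam \<theta> n"
proof -
  have "\<bar>mag \<eta>\<bar> \<le> (\<Sum>x<n. \<bar>spin \<eta> x\<bar>)" unfolding mag_def by (rule sum_abs)
  also have "\<dots> = (\<Sum>x<n. 1)" using spin_cases[OF assms] by (intro sum.cong) force+
  finally have "\<bar>mag \<eta>\<bar> \<le> real n" by simp
  then have "gam \<theta> n * \<bar>mag \<eta>\<bar> \<le> gam \<theta> n * real n" using gam by (intro mult_left_mono) auto
  then show ?thesis using gam n_pos by (simp add: \<tau>_def abs_mult divide_le_eq)
qed

lemma nu_U_weight_eq:
  "nu_U_weight \<theta> n \<eta> = exp (real n / gam \<theta> n * tilted_log (\<tau> \<eta>) (\<tau> \<eta>))"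
proof -
  have "(\<Sum>x<n. real (\<eta> x) - 1 / 2) = mag \<eta> / 2"
    unfolding mag_def spin_def sum_divide_distrib by (intro sum.cong) (auto simp: field_simps)
  then have "2 * gam \<theta> n * ((1 / real n) * (\<Sum>x<n. real (\<eta> x) - 1 / 2)) = \<tau> \<eta>"
    by (simp add: \<tau>_def)
  then show ?thesis unfolding nu_U_weight_def potential_def tilted_log_def by simp
qed

text \<open>The Bernoulli factors are (1 + t)^2 and (1 - t)^2 over 2 (1 + t^2). The normalisation
  cancels against 2^n and the first factor of w, and the rest combines to (1 + t)^(n / \<gamma> + S)
  (1 - t)^(n / \<gamma> - S).\<close>

lemma mixture_integrand:
  assumes s: "s \<in> {-L..L}" and \<eta>: "\<eta> \<in> Omega n"
  shows "2 ^ n * (conf.w s * bern_weight n (field_prob (s / q)) \<eta>) =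
    exp (real n / gam \<theta> n * tilted_log (\<tau> \<eta>) (s / q))"
proof -
  define t where "t = s / q"
  have t: "0 < 1 + t" "0 < 1 - t" "0 < 1 + t\<^sup>2"
  proof -
    have "\<bar>t\<bar> < 1" using abs_rescaled_le[OF s] T unfolding t_def by linarith
    then show "0 < 1 + t" "0 < 1 - t" "0 < 1 + t\<^sup>2" by (auto simp: add_pos_nonneg abs_less_iff)
  qed
  let ?l = "ln (1 + t)" and ?m = "ln (1 - t)" and ?k = "ln 2 + ln (1 + t\<^sup>2)"
  have fac: "(if \<eta> x = 1 then field_prob t else 1 - field_prob t) =
      exp ((1 + spin \<eta> x) * ?l + (1 - spin \<eta> x) * ?m - ?k)" if "x < n" for x
  proof -
    have e: "exp (2 * ln y - ?k) = y\<^sup>2 / (2 * (1 + t\<^sup>2))" if "0 < y" for y :: real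
      using that t by (simp add: exp_diff exp_add exp_double)
    have "\<eta> x = 0 \<or> \<eta> x = 1" using Omega_values[OF \<eta> that] .
    then show ?thesis
      using e[OF t(1)] e[OF t(2)] field_prob_compl[of t] by (auto simp: spin_def field_prob_def)
  qed
  have "bern_weight n (field_prob t) \<eta> = exp (\<Sum>x<n. (1 + spin \<eta> x) * ?l + (1 - spin \<eta> x) * ?m - ?k)"
    unfolding bern_weight_def using fac by (simp add: exp_sum)
  also have "(\<Sum>x<n. (1 + spin \<eta> x) * ?l + (1 - spin \<eta> x) * ?m - ?k) =
      (real n + mag \<eta>) * ?l + (real n - mag \<eta>) * ?m - real n * ?k"
    by (simp add: mag_def sum.distrib sum_subtractf sum_distrib_right[symmetric])
  finally have bw: "bern_weight n (field_prob t) \<eta> = exp ((real n + mag \<eta>) * ?l + (real n - mag \<eta>) * ?m - real n * ?k)" .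
  have "ln (1 - t\<^sup>2) = ?l + ?m"
  proof -
    have "1 - t\<^sup>2 = (1 + t) * (1 - t)" by (simp add: power2_eq_square algebra_simps)
    then show ?thesis using t by (simp only: ln_mult_pos)
  qed
  moreover have "q ^ 4 + b * q\<^sup>2 = real n / gam \<theta> n - real n"
  proof -
    have "real n / gam \<theta> n = q ^ 4 * (1 / gam \<theta> n)" by (simp add: q)
    also have "\<dots> = 2 * q ^ 4 + b * q\<^sup>2" unfolding inverse_gam using q_pos
      by (simp add: algebra_simps power4_eq_xxxx power2_eq_square)
    finally show ?thesis using q by simp
  qed
  ultimately have w: "conf.w s = exp (real n * ln (1 + t\<^sup>2) + (real n / gam \<theta> n - real n) * (?l + ?m))"
    unfolding conf.w_def V_def t_def[symmetric] using q by simp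
  have two: "(2::real) ^ n = exp (real n * ln 2)" by (simp add: exp_of_nat_mult)
  have mt: "real n / gam \<theta> n * \<tau> \<eta> = mag \<eta>" using gam n_pos by (simp add: \<tau>_def)
  have "real n / gam \<theta> n * tilted_log (\<tau> \<eta>) t = (real n / gam \<theta> n + mag \<eta>) * ?l + (real n / gam \<theta> n - mag \<eta>) * ?m"
    unfolding tilted_log_def mt[symmetric] by (simp add: distrib_left distrib_right left_diff_distrib right_diff_distrib mult.assoc)
  then show ?thesis
    unfolding t_def[symmetric] bw w two by (simp add: exp_add[symmetric] algebra_simps)
qed

lemma cont_field_prob: "continuous_on {-L..L} (\<lambda>s. field_prob (s / q))"
proof -
  have *: "2 * (1 + (s / q)\<^sup>2) \<noteq> 0" for s
    using add_pos_nonneg[OF zero_less_one zero_le_power2, of "s / q"] by simp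
  show ?thesis
    unfolding field_prob_def using q_pos by (intro continuous_intros ballI *) auto
qed

lemma cont_bern_weight: "continuous_on {-L..L} (\<lambda>s. bern_weight n (field_prob (s / q)) \<eta>)"
proof -
  have "continuous_on {-L..L} (\<lambda>s. if \<eta> x = 1 then field_prob (s / q) else 1 - field_prob (s / q))" for x
    by (cases "\<eta> x = 1") (simp_all add: cont_field_prob continuous_on_diff)
  then show ?thesis unfolding bern_weight_def by (intro continuous_on_prod)
qed

lemma cont_bern_exp: "continuous_on {-L..L} (\<lambda>s. bern_exp n (field_prob (s / q)) h)"
  unfolding bern_exp_def by (intro continuous_intros cont_bern_weight)

lemma integral_bern_exp:
  "integral {-L..L} (\<lambda>s. conf.w s * bern_exp n (field_prob (s / q)) h) = (\<Sum>\<eta>\<in>Omega n. mixture \<eta> * h \<eta>)"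
proof -
  have "integral {-L..L} (\<lambda>s. conf.w s * bern_exp n (field_prob (s / q)) h) =
     integral {-L..L} (\<lambda>s. \<Sum>\<eta>\<in>Omega n. conf.w s * bern_weight n (field_prob (s / q)) \<eta> * h \<eta>)"
    unfolding bern_exp_def by (simp add: sum_distrib_left mult.assoc)
  also have "\<dots> = (\<Sum>\<eta>\<in>Omega n. integral {-L..L} (\<lambda>s. conf.w s * bern_weight n (field_prob (s / q)) \<eta> * h \<eta>))"
    by (intro integral_sum finite_Omega integrable_continuous_interval continuous_intros cont_bern_weight conf.cont_w)
  finally show ?thesis by (simp add: mixture_def)
qed

text \<open>The Gaussian bound exp (- y) is weakened to the Cauchy kernel 1 / (1 + y), whose
  integral is an explicit arctan difference; this is the source of \<open>pi\<close>. The kernel has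
  width of order 1 / q in s, hence the factor q.\<close>

lemma mixture_upper:
  assumes \<eta>: "\<eta> \<in> Omega n"
  shows "q * 2 ^ n * mixture \<eta> \<le> 2 * pi * nu_U_weight \<theta> n \<eta>"
proof -
  let ?\<tau> = "\<tau> \<eta>"
  have \<tau>1: "\<bar>?\<tau>\<bar> < 1" using tau_bound[OF \<eta>] gam by linarith
  let ?u = "nu_U_weight \<theta> n \<eta>"
  let ?k = "\<lambda>s. inverse (1 + (q / 2 * (s - q * ?\<tau>))\<^sup>2)"
  have kne: "1 + (q / 2 * (s - q * ?\<tau>))\<^sup>2 \<noteq> 0" for s
    by (metis add_pos_nonneg less_numeral_extra(1,3) zero_le_power2)
  have pt: "2 ^ n * (conf.w s * bern_weight n (field_prob (s / q)) \<eta>) \<le> ?u * ?k s" if s: "s \<in> {-L..L}" for s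
  proof -
    have t1: "\<bar>s / q\<bar> < 1" using abs_rescaled_le[OF s] T by linarith
    let ?y = "(q / 2 * (s - q * ?\<tau>))\<^sup>2"
    have N: "real n \<le> real n / gam \<theta> n" using gam n_pos by (simp add: le_divide_eq)
    have y: "?y = real n * ((s / q - ?\<tau>)\<^sup>2 / 4)"
      unfolding q(3)[symmetric] using q_pos
      by (simp add: power_mult_distrib power_divide field_simps power4_eq_xxxx power2_eq_square)
    have "real n / gam \<theta> n * tilted_log ?\<tau> (s / q) \<le> real n / gam \<theta> n * (tilted_log ?\<tau> ?\<tau> - (s / q - ?\<tau>)\<^sup>2 / 4)"
      using relative_log_upper[OF t1 \<tau>1] gam unfolding tilted_log_def by (intro mult_left_mono) auto
    also have "\<dots> \<le> real n / gam \<theta> n * tilted_log ?\<tau> ?\<tau> - ?y"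
      unfolding y unfolding right_diff_distrib
      by (intro diff_left_mono mult_right_mono N) simp
    finally have "exp (real n / gam \<theta> n * tilted_log ?\<tau> (s / q)) \<le> exp (real n / gam \<theta> n * tilted_log ?\<tau> ?\<tau> - ?y)"
      unfolding exp_le_cancel_iff .
    also have "\<dots> = ?u * inverse (exp ?y)" unfolding nu_U_weight_eq by (simp only: exp_diff divide_inverse)
    also have "\<dots> \<le> ?u * ?k s"
    proof (intro mult_left_mono le_imp_inverse_le)
      show "1 + ?y \<le> exp ?y" by (rule exp_ge_add_one_self)
    qed (auto simp: nu_U_weight_eq add_pos_nonneg)
    finally show ?thesis unfolding mixture_integrand[OF s \<eta>] .
  qed
  have cw: "continuous_on {-L..L} (\<lambda>s. 2 ^ n * (conf.w s * bern_weight n (field_prob (s / q)) \<eta>))"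
    by (intro continuous_intros conf.cont_w cont_bern_weight)
  have ck: "continuous_on {-L..L} (\<lambda>s. ?u * ?k s)"
    using kne by (intro continuous_intros) auto
  have "(?k has_integral (2 / q * arctan (q / 2 * (L - q * ?\<tau>)) - 2 / q * arctan (q / 2 * (- L - q * ?\<tau>)))) {-L..L}"
  proof (rule fundamental_theorem_of_calculus)
    fix s
    have "((\<lambda>s. 2 / q * arctan (q / 2 * (s - q * ?\<tau>))) has_real_derivative ?k s) (at s)"
    proof -
      have "((\<lambda>s. q / 2 * (s - q * ?\<tau>)) has_real_derivative q / 2) (at s)"
        by (auto intro!: derivative_eq_intros)
      from DERIV_cmult[OF DERIV_chain2[OF DERIV_arctan this], of "2 / q"]
      show ?thesis by (rule DERIV_cong) (use q_pos in simp)
    qed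
    then show "((\<lambda>s. 2 / q * arctan (q / 2 * (s - q * ?\<tau>))) has_vector_derivative ?k s) (at s within {-L..L})"
      unfolding has_real_derivative_iff_has_vector_derivative by (rule has_vector_derivative_at_within)
  qed (use L_pos in simp)
  then have "integral {-L..L} ?k = 2 / q * arctan (q / 2 * (L - q * ?\<tau>)) - 2 / q * arctan (q / 2 * (- L - q * ?\<tau>))"
    by (rule integral_unique)
  also have "\<dots> = 2 / q * (arctan (q / 2 * (L - q * ?\<tau>)) - arctan (q / 2 * (- L - q * ?\<tau>)))"
    by (rule right_diff_distrib[symmetric])
  also have "\<dots> \<le> 2 / q * pi"
    using q_pos arctan_ubound[of "q / 2 * (L - q * ?\<tau>)"] arctan_lbound[of "q / 2 * (- L - q * ?\<tau>)"]
    by (intro mult_left_mono) auto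
  finally have k: "integral {-L..L} ?k \<le> 2 / q * pi" .
  have "2 ^ n * mixture \<eta> = integral {-L..L} (\<lambda>s. 2 ^ n * (conf.w s * bern_weight n (field_prob (s / q)) \<eta>))"
    by (simp add: mixture_def)
  also have "\<dots> \<le> integral {-L..L} (\<lambda>s. ?u * ?k s)"
    using pt by (intro integral_le_cont cw ck)
  also have "\<dots> = ?u * integral {-L..L} ?k" by simp
  also have "\<dots> \<le> ?u * (2 / q * pi)" using k by (intro mult_left_mono) (auto simp: nu_U_weight_def)
  finally show ?thesis using q_pos by (simp add: field_simps)
qed

text \<open>On a window of length e / q to the right of the saddle, n (t - \<tau>)^2 is at most 1,
  so by \<open>relative_log_lower\<close> the exponent drops by at most K below its maximum.\<close>

lemma mixture_lower:
  assumes \<eta>: "\<eta> \<in> Omega n"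
  shows "mixture_const r * nu_U_weight \<theta> n \<eta> \<le> q * 2 ^ n * mixture \<eta>"
proof -
  let ?\<tau> = "\<tau> \<eta>"
  have \<tau>1: "\<bar>?\<tau>\<bar> < 1" "\<bar>?\<tau>\<bar> \<le> (1 + r) / 2" using tau_bound[OF \<eta>] gam by linarith+
  let ?u = "nu_U_weight \<theta> n \<eta>"
  \<comment> \<open>Exactly the margin T - (1 + r) / 2 between cutoff and saddle range, so the
    window stays inside the interval.\<close>
  define e where "e = (1 - r) / 4"
  define K where "K = 4 / ((1 - r) * (1 - T\<^sup>2))"
  have e: "0 < e" "e \<le> 1" using r by (auto simp: e_def)
  have T2: "0 < 1 - T\<^sup>2" using T by (simp add: power_less_one_iff)
  define lo hi where "lo = q * ?\<tau>" and "hi = q * ?\<tau> + e / q"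
  have eq: "e / q \<le> e * q" using e q by (simp add: divide_le_eq) (smt (verit) mult_le_cancel_left1 mult_left_le mult_le_cancel_left_pos)
  have sub: "- L \<le> lo" "hi \<le> L"
  proof -
    have "- T \<le> ?\<tau>" "?\<tau> + e \<le> T" 
      using abs_le_D1[OF \<tau>1(2)] abs_le_D2[OF \<tau>1(2)] r by (simp_all add: e_def field_cutoff_def field_simps)
    then have "q * (- T) \<le> q * ?\<tau>" "q * (?\<tau> + e) \<le> q * T" using q_pos by (intro mult_left_mono; simp)+
    then show "- L \<le> lo" "hi \<le> L" using eq by (auto simp: lo_def hi_def algebra_simps)
  qed
  have lohi: "lo \<le> hi" using e q_pos by (simp add: lo_def hi_def)
  have pt: "?u * exp (- K) \<le> 2 ^ n * (conf.w s * bern_weight n (field_prob (s / q)) \<eta>)" if s: "s \<in> {lo..hi}" for s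
  proof -
    have sL: "s \<in> {-L..L}" using s sub by auto
    have t1: "\<bar>s / q\<bar> < 1" using abs_rescaled_le[OF sL] T by linarith
    have "0 \<le> s - lo" "s - lo \<le> e / q" using s by (auto simp: lo_def hi_def)
    then have "0 \<le> q * (s - lo)" "q * (s - lo) \<le> q * (e / q)" using q_pos by (simp, intro mult_left_mono) auto
    then have "0 \<le> q * (s - lo)" "q * (s - lo) \<le> 1" using e q_pos by auto
    then have "(q * (s - lo))\<^sup>2 \<le> 1" by (simp add: power_le_one)
    moreover have "(q * (s - lo))\<^sup>2 = real n * (s / q - ?\<tau>)\<^sup>2"
      unfolding q(3)[symmetric] lo_def using q_pos
      by (simp add: power_mult_distrib power_divide field_simps power4_eq_xxxx power2_eq_square)
    ultimately have n1: "real n * (s / q - ?\<tau>)\<^sup>2 \<le> 1" by simp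
    have "real n / gam \<theta> n * (2 * (s / q - ?\<tau>)\<^sup>2 / (1 - (s / q)\<^sup>2)) = 2 * (real n * (s / q - ?\<tau>)\<^sup>2) / (gam \<theta> n * (1 - (s / q)\<^sup>2))"
      by simp
    also have "\<dots> \<le> 2 * 1 / ((1 - r) / 2 * (1 - T\<^sup>2))"
    proof (rule frac_le)
      show "(1 - r) / 2 * (1 - T\<^sup>2) \<le> gam \<theta> n * (1 - (s / q)\<^sup>2)"
        using gam T2 rescaled_bounds[OF sL] by (intro mult_mono) auto
    qed (use n1 r T2 in auto)
    also have "\<dots> = K" by (simp add: K_def)
    finally have 1: "real n / gam \<theta> n * (2 * (s / q - ?\<tau>)\<^sup>2 / (1 - (s / q)\<^sup>2)) \<le> K" .
    have "real n / gam \<theta> n * (tilted_log ?\<tau> ?\<tau> - 2 * (s / q - ?\<tau>)\<^sup>2 / (1 - (s / q)\<^sup>2)) \<le> real n / gam \<theta> n * tilted_log ?\<tau> (s / q)"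
      using relative_log_lower[OF t1 \<tau>1(1)] gam unfolding tilted_log_def by (intro mult_left_mono) auto
    then have "real n / gam \<theta> n * tilted_log ?\<tau> ?\<tau> - K \<le> real n / gam \<theta> n * tilted_log ?\<tau> (s / q)"
      using 1 unfolding right_diff_distrib by linarith
    then have "exp (real n / gam \<theta> n * tilted_log ?\<tau> ?\<tau> + - K) \<le> exp (real n / gam \<theta> n * tilted_log ?\<tau> (s / q))" by simp
    then show ?thesis unfolding mixture_integrand[OF sL \<eta>] unfolding nu_U_weight_eq exp_add .
  qed
  have cw: "continuous_on {-L..L} (\<lambda>s. 2 ^ n * (conf.w s * bern_weight n (field_prob (s / q)) \<eta>))"
    by (intro continuous_intros conf.cont_w cont_bern_weight)
  have "e / q * (?u * exp (- K)) = integral {lo..hi} (\<lambda>s. ?u * exp (- K))"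
    using lohi by (simp add: lo_def hi_def)
  also have "\<dots> \<le> integral {lo..hi} (\<lambda>s. 2 ^ n * (conf.w s * bern_weight n (field_prob (s / q)) \<eta>))"
    by (intro integral_le_cont continuous_on_const continuous_on_subset[OF cw] pt) (use sub in auto)
  also have "\<dots> \<le> integral {-L..L} (\<lambda>s. 2 ^ n * (conf.w s * bern_weight n (field_prob (s / q)) \<eta>))"
  proof (rule integral_subinterval_le[OF cw _ sub])
    fix s assume s: "s \<in> {-L..L}"
    show "0 \<le> 2 ^ n * (conf.w s * bern_weight n (field_prob (s / q)) \<eta>)"
      unfolding mixture_integrand[OF s \<eta>] by simp
  qed
  also have "\<dots> = 2 ^ n * mixture \<eta>" by (simp add: mixture_def)
  finally have "q * (e / q * (?u * exp (- K))) \<le> q * (2 ^ n * mixture \<eta>)" using q_pos by (intro mult_left_mono) auto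
  then show ?thesis using q_pos by (simp add: mixture_const_def e_def K_def mult_ac)
qed

end

section \<open>Entropy bound\<close>

definition prob_floor :: "real \<Rightarrow> real" where "prob_floor r = (1 - field_cutoff r)\<^sup>2 / 4"

text \<open>The prefactor is the ratio of the two constants comparing the mixture with
  \<open>nu_U\<close>; the 2 is the product log-Sobolev constant, the last term the contribution of
  the mixing law.\<close>

definition entropy_const :: "real \<Rightarrow> real \<Rightarrow> real" where
  "entropy_const \<theta> r = 2 * pi / mixture_const r *
     (2 + log_sobolev_const (core_bound \<theta> r) (core_radius \<theta> r) / prob_floor r ^ 3)"

context curie_weiss begin

abbreviation "\<delta> \<equiv> prob_floor r"

lemma prob_floor_pos: "0 < \<delta>" using T by (simp add: prob_floor_def)

lemma mixture_const_pos: "0 < mixture_const r" using r by (simp add: mixture_const_def)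

lemma log_sobolev_const_nonneg: "0 \<le> log_sobolev_const A R"
  using conf.A_pos R_pos by (simp add: log_sobolev_const_def poincare_const_def)

lemma entropy_const_pos: "0 < entropy_const \<theta> r"
  unfolding entropy_const_def using mixture_const_pos prob_floor_pos log_sobolev_const_nonneg
  by (intro mult_pos_pos divide_pos_pos add_pos_nonneg divide_nonneg_pos) auto

section \<open>Bernoulli averages of a fixed density along the mixing law\<close>

context
  fixes f :: "(nat \<Rightarrow> nat) \<Rightarrow> real"
  assumes f: "\<And>\<eta>. \<eta> \<in> Omega n \<Longrightarrow> 0 \<le> f \<eta>"
    and f_pos: "\<exists>\<eta>\<in>Omega n. 0 < f \<eta>"
begin

abbreviation prob_at :: "real \<Rightarrow> real" where "prob_at s \<equiv> field_prob (s / q)"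

definition F :: "real \<Rightarrow> real" where "F s = bern_exp n (prob_at s) f"

definition F' :: "real \<Rightarrow> real" where
  "F' s = (\<Sum>x<n. bern_exp n (prob_at s) (\<lambda>\<eta>. (real (\<eta> x) - prob_at s) * f \<eta>)) / (prob_at s * (1 - prob_at s))
     * ((1 - (s / q)\<^sup>2) / (1 + (s / q)\<^sup>2)\<^sup>2 / q)"

lemma prob_at:
  assumes "s \<in> {-L..L}"
  shows "\<delta> \<le> prob_at s" "prob_at s \<le> 1 - \<delta>" "0 < prob_at s" "prob_at s < 1"
proof -
  show 1: "\<delta> \<le> prob_at s" "prob_at s \<le> 1 - \<delta>"
    unfolding prob_floor_def by (intro field_prob_bounds[OF abs_rescaled_le[OF assms] T(2)])+
  show "0 < prob_at s" "prob_at s < 1" using 1 prob_floor_pos by linarith+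
qed

lemma F_pos: assumes "s \<in> {-L..L}" shows "0 < F s"
proof -
  obtain \<eta> where \<eta>: "\<eta> \<in> Omega n" "0 < f \<eta>" using f_pos by blast
  have W: "0 < bern_weight n (prob_at s) \<zeta>" for \<zeta> using prob_at[OF assms] by (intro bern_weight_pos)
  show ?thesis unfolding F_def bern_exp_def
    using \<eta> W f by (intro sum_pos2[of _ \<eta>] finite_Omega) (auto intro: less_imp_le mult_nonneg_nonneg)
qed

lemma F_deriv: assumes "s \<in> {-L..L}" shows "(F has_real_derivative F' s) (at s)"
proof -
  have "((\<lambda>s. s / q) has_real_derivative 1 / q) (at s)"
    using q_pos by (auto intro!: derivative_eq_intros)
  from DERIV_chain2[OF field_prob_deriv this]
  have "(prob_at has_real_derivative (1 - (s / q)\<^sup>2) / (1 + (s / q)\<^sup>2)\<^sup>2 / q) (at s)" by simp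
  from DERIV_chain2[OF bern_exp_deriv[OF prob_at(3,4)[OF assms]] this]
  show ?thesis unfolding F_def F'_def .
qed

lemma cont_F': "continuous_on {-L..L} F'"
proof -
  have 1: "1 + (s / q)\<^sup>2 \<noteq> 0" for s
    using add_pos_nonneg[OF zero_less_one zero_le_power2, of "s / q"] by simp
  have 2: "(1 + (s / q)\<^sup>2)\<^sup>2 \<noteq> 0" for s unfolding power_eq_0_iff using 1[of s] by blast
  have 3: "prob_at s * (1 - prob_at s) \<noteq> 0" if "s \<in> {-L..L}" for s using prob_at(3,4)[OF that] by simp
  have 4: "q \<noteq> 0" using q_pos by simp
  show ?thesis
    unfolding F'_def bern_exp_def
    by (intro continuous_intros cont_bern_weight cont_field_prob ballI 2 3 4)
qed

text \<open>The factor F in \<open>bern_gradient\<close> cancels against the derivative of the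
  square root. The rescaling t = s / q divides by q^2, so n becomes n / q^2 = q^2.\<close>

lemma sqrt_F_deriv_sq:
  assumes s: "s \<in> {-L..L}"
  shows "(F' s / (2 * sqrt (F s)))\<^sup>2 \<le> q\<^sup>2 / \<delta> ^ 3 * glauber_form n (prob_at s) f"
proof -
  let ?S = "(\<Sum>x<n. bern_exp n (prob_at s) (\<lambda>\<eta>. (real (\<eta> x) - prob_at s) * f \<eta>)) / (prob_at s * (1 - prob_at s))"
  let ?d = "(1 - (s / q)\<^sup>2) / (1 + (s / q)\<^sup>2)\<^sup>2"
  have d: "0 \<le> ?d" "?d \<le> 1"
  proof -
    have a: "0 \<le> 1 - (s / q)\<^sup>2" using rescaled_bounds(3)[OF s] by simp
    then show "0 \<le> ?d" by simp
    have "1 \<le> (1 + (s / q)\<^sup>2)\<^sup>2" by (simp add: one_le_power)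
    then have "?d \<le> 1 / 1" using a by (intro frac_le) auto
    then show "?d \<le> 1" by simp
  qed
  have "(F' s)\<^sup>2 = ?S\<^sup>2 * ?d\<^sup>2 / q\<^sup>2" by (simp add: F'_def power_mult_distrib power_divide)
  also have "\<dots> \<le> ?S\<^sup>2 * 1 / q\<^sup>2"
    using d by (intro divide_right_mono mult_left_mono power_le_one) auto
  also have "\<dots> \<le> (real n * 4 / \<delta> ^ 3 * F s * glauber_form n (prob_at s) f) / q\<^sup>2"
    using bern_gradient[of \<delta> "prob_at s" n f, OF prob_floor_pos prob_at(1,2)[OF s] f] unfolding F_def by (intro divide_right_mono) auto
  also have "\<dots> = 4 * F s * (q\<^sup>2 / \<delta> ^ 3 * glauber_form n (prob_at s) f)"
    unfolding q(3)[symmetric] using q_pos by (simp add: power4_eq_xxxx power2_eq_square)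
  finally have "(F' s)\<^sup>2 / (4 * F s) \<le> q\<^sup>2 / \<delta> ^ 3 * glauber_form n (prob_at s) f"
    using F_pos[OF s] by (simp add: divide_le_eq mult.commute)
  moreover have "(F' s / (2 * sqrt (F s)))\<^sup>2 = (F' s)\<^sup>2 / (4 * F s)"
    using F_pos[OF s] by (simp add: power_divide power_mult_distrib)
  ultimately show ?thesis by simp
qed

lemma sum_glauber: "bern_exp n p (\<lambda>\<eta>. \<Sum>x<n. h x \<eta>) = (\<Sum>x<n. bern_exp n p (h x))"
  unfolding bern_exp_def sum_distrib_left by (rule sum.swap)

text \<open>Proved first for the weights \<open>mixture\<close>, by the entropy chain rule, and then
  transferred: the left side by \<open>mixture_lower\<close>, the form on the right by
  \<open>mixture_upper\<close>.\<close>

lemma weighted_entropy_le: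
  obtains c where "0 < c"
    "(\<Sum>\<eta>\<in>Omega n. nu_U_weight \<theta> n \<eta> * ent_gap (f \<eta>) c) \<le>
      entropy_const \<theta> r * sqrt (real n) *
        (\<Sum>\<eta>\<in>Omega n. nu_U_weight \<theta> n \<eta> * (\<Sum>x<n. (sqrt (f (flip x \<eta>)) - sqrt (f \<eta>))\<^sup>2))"
proof -
  let ?G = "\<lambda>s. sqrt (F s)" and ?G' = "\<lambda>s. F' s / (2 * sqrt (F s))"
  let ?W = "nu_U_weight \<theta> n" and ?D = "\<lambda>\<eta>. \<Sum>x<n. (sqrt (f (flip x \<eta>)) - sqrt (f \<eta>))\<^sup>2"
  let ?K = "log_sobolev_const A R"
  have cF: "continuous_on {-L..L} F" unfolding F_def by (rule cont_bern_exp)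
  have dG: "(?G has_real_derivative ?G' s) (at s within {-L..L})" if s: "s \<in> {-L..L}" for s
    using F_pos[OF s] by (auto intro!: derivative_eq_intros has_field_derivative_at_within[OF F_deriv[OF s]] simp: field_simps)
  have cG': "continuous_on {-L..L} ?G'"
    using F_pos by (intro continuous_intros cont_F' cF) force
  obtain c where c: "0 < c" and ls: "integral {-L..L} (\<lambda>s. conf.w s * ent_gap ((?G s)\<^sup>2) c) \<le>
      ?K * integral {-L..L} (\<lambda>s. conf.w s * (?G' s)\<^sup>2)"
    using conf.log_sobolev[OF dG cG'] F_pos by auto
  have G2: "(?G s)\<^sup>2 = F s" if "s \<in> {-L..L}" for s using F_pos[OF that] by simp
  have gf: "glauber_form n p f = bern_exp n p ?D" for p
    unfolding glauber_form_def sum_glauber ..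
  define J where "J = integral {-L..L} (\<lambda>s. conf.w s * bern_exp n (prob_at s) ?D)"
  have J0: "0 \<le> J" unfolding J_def
    using prob_at by (intro integral_nonneg integrable_continuous_interval continuous_intros conf.cont_w cont_bern_exp)
      (auto intro!: mult_nonneg_nonneg bern_exp_nonneg sum_nonneg)
  have ce: "continuous_on {-L..L} (\<lambda>s. ent_gap (F s) c)"
    unfolding ent_gap_def using F_pos by (intro continuous_intros cF) force+
  have "(\<Sum>\<eta>\<in>Omega n. mixture \<eta> * ent_gap (f \<eta>) c) =
      integral {-L..L} (\<lambda>s. conf.w s * bern_exp n (prob_at s) (\<lambda>\<eta>. ent_gap (f \<eta>) c))"
    by (rule integral_bern_exp[symmetric])
  also have "\<dots> \<le> integral {-L..L} (\<lambda>s. 2 * (conf.w s * bern_exp n (prob_at s) ?D) + conf.w s * ent_gap (F s) c)"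
  proof (intro integral_le_cont continuous_on_add continuous_on_mult continuous_on_const conf.cont_w cont_bern_exp ce)
    fix s assume s: "s \<in> {-L..L}"
    \<comment> \<open>Chain rule: the gap of f to c averages to the Bernoulli entropy of f plus the
      gap of its mean F s to the same c.\<close>
    have "bern_exp n (prob_at s) (\<lambda>\<eta>. ent_gap (f \<eta>) c) =
        bern_exp n (prob_at s) (\<lambda>\<eta>. f \<eta> * ln (f \<eta>)) - F s * ln (F s) + ent_gap (F s) c"
    proof -
      have "bern_exp n (prob_at s) (\<lambda>\<eta>. ent_gap (f \<eta>) c) =
          bern_exp n (prob_at s) (\<lambda>\<eta>. f \<eta> * ln (f \<eta>)) - bern_exp n (prob_at s) (\<lambda>\<eta>. ln c * f \<eta>) - F s + c"
        unfolding ent_gap_def F_def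
        by (simp add: bern_exp_add bern_exp_diff bern_exp_const mult.commute)
      then show ?thesis by (simp add: bern_exp_cmult ent_gap_def F_def mult.commute)
    qed
    also have "\<dots> \<le> 2 * bern_exp n (prob_at s) ?D + ent_gap (F s) c"
      using bernoulli_log_sobolev[of "prob_at s" n f, OF prob_at(3,4)[OF s] f] unfolding gf F_def by simp
    finally have "conf.w s * bern_exp n (prob_at s) (\<lambda>\<eta>. ent_gap (f \<eta>) c) \<le>
        conf.w s * (2 * bern_exp n (prob_at s) ?D + ent_gap (F s) c)"
      by (intro mult_left_mono) auto
    then show "conf.w s * bern_exp n (prob_at s) (\<lambda>\<eta>. ent_gap (f \<eta>) c) \<le>
        2 * (conf.w s * bern_exp n (prob_at s) ?D) + conf.w s * ent_gap (F s) c"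
      by (simp add: algebra_simps)
  qed
  also have "\<dots> = integral {-L..L} (\<lambda>s. 2 * (conf.w s * bern_exp n (prob_at s) ?D)) + integral {-L..L} (\<lambda>s. conf.w s * ent_gap (F s) c)"
    by (intro integral_add integrable_continuous_interval ce continuous_on_mult continuous_on_const conf.cont_w cont_bern_exp)
  also have "integral {-L..L} (\<lambda>s. conf.w s * ent_gap (F s) c) = integral {-L..L} (\<lambda>s. conf.w s * ent_gap ((?G s)\<^sup>2) c)"
    using G2 by (intro integral_cong) auto
  also note ls
  also have "integral {-L..L} (\<lambda>s. conf.w s * (?G' s)\<^sup>2) \<le> integral {-L..L} (\<lambda>s. q\<^sup>2 / \<delta> ^ 3 * (conf.w s * bern_exp n (prob_at s) ?D))"
  proof (intro integral_le_cont)
    show "continuous_on {-L..L} (\<lambda>s. conf.w s * (?G' s)\<^sup>2)" by (intro continuous_on_mult conf.cont_w continuous_on_power cG')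
    show "continuous_on {-L..L} (\<lambda>s. q\<^sup>2 / \<delta> ^ 3 * (conf.w s * bern_exp n (prob_at s) ?D))"
      by (intro continuous_on_mult continuous_on_const conf.cont_w cont_bern_exp)
    fix s assume s: "s \<in> {-L..L}"
    have "conf.w s * (?G' s)\<^sup>2 \<le> conf.w s * (q\<^sup>2 / \<delta> ^ 3 * bern_exp n (prob_at s) ?D)"
      using sqrt_F_deriv_sq[OF s] unfolding gf by (intro mult_left_mono) auto
    then show "conf.w s * (?G' s)\<^sup>2 \<le> q\<^sup>2 / \<delta> ^ 3 * (conf.w s * bern_exp n (prob_at s) ?D)"
      by (simp add: mult_ac)
  qed
  finally have 1: "(\<Sum>\<eta>\<in>Omega n. mixture \<eta> * ent_gap (f \<eta>) c) \<le> 2 * J + ?K * (q\<^sup>2 / \<delta> ^ 3 * J)"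
    using log_sobolev_const_nonneg by (simp add: J_def mult_left_mono)
  also have "\<dots> \<le> (2 + ?K / \<delta> ^ 3) * q\<^sup>2 * J"
  proof -
    have "1 * J \<le> q\<^sup>2 * J" using one_le_power[OF q(1)] J0 by (intro mult_right_mono)
    then show ?thesis by (simp add: algebra_simps)
  qed
  finally have 2: "(\<Sum>\<eta>\<in>Omega n. mixture \<eta> * ent_gap (f \<eta>) c) \<le> (2 + ?K / \<delta> ^ 3) * q\<^sup>2 * J" .
  have 3: "q * 2 ^ n * J \<le> 2 * pi * (\<Sum>\<eta>\<in>Omega n. ?W \<eta> * ?D \<eta>)"
  proof -
    have "q * 2 ^ n * J = (\<Sum>\<eta>\<in>Omega n. q * 2 ^ n * mixture \<eta> * ?D \<eta>)"
      unfolding J_def integral_bern_exp by (simp add: sum_distrib_left mult.assoc)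
    also have "\<dots> \<le> (\<Sum>\<eta>\<in>Omega n. 2 * pi * ?W \<eta> * ?D \<eta>)"
      by (intro sum_mono mult_right_mono mixture_upper sum_nonneg) auto
    finally show ?thesis by (simp add: sum_distrib_left mult.assoc)
  qed
  have "mixture_const r * (\<Sum>\<eta>\<in>Omega n. ?W \<eta> * ent_gap (f \<eta>) c) = (\<Sum>\<eta>\<in>Omega n. mixture_const r * ?W \<eta> * ent_gap (f \<eta>) c)"
    by (simp add: sum_distrib_left mult.assoc)
  \<comment> \<open>The comparison of weights is legitimate term by term because
    \<open>ent_gap\<close> is nonnegative; f ln f itself has no sign.\<close>
  also have "\<dots> \<le> (\<Sum>\<eta>\<in>Omega n. q * 2 ^ n * mixture \<eta> * ent_gap (f \<eta>) c)"
    using f c by (intro sum_mono mult_right_mono mixture_lower ent_gap_nonneg) auto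
  also have "\<dots> = q * 2 ^ n * (\<Sum>\<eta>\<in>Omega n. mixture \<eta> * ent_gap (f \<eta>) c)"
    by (simp add: sum_distrib_left mult.assoc)
  also have "\<dots> \<le> q * 2 ^ n * ((2 + ?K / \<delta> ^ 3) * q\<^sup>2 * J)"
    using 2 q_pos by (intro mult_left_mono) auto
  \<comment> \<open>The normalisation \<open>q * 2 ^ n\<close> occurs in both comparisons and is
    absorbed by the upper one, so the net loss is q^2 = sqrt n.\<close>
  also have "\<dots> = (2 + ?K / \<delta> ^ 3) * q\<^sup>2 * (q * 2 ^ n * J)" by (simp only: mult_ac)
  also have "\<dots> \<le> (2 + ?K / \<delta> ^ 3) * q\<^sup>2 * (2 * pi * (\<Sum>\<eta>\<in>Omega n. ?W \<eta> * ?D \<eta>))"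
    using 3 prob_floor_pos log_sobolev_const_nonneg by (intro mult_left_mono) auto
  finally have "(\<Sum>\<eta>\<in>Omega n. ?W \<eta> * ent_gap (f \<eta>) c) \<le>
      ((2 + ?K / \<delta> ^ 3) * q\<^sup>2 * (2 * pi * (\<Sum>\<eta>\<in>Omega n. ?W \<eta> * ?D \<eta>))) / mixture_const r"
    using mixture_const_pos by (simp add: le_divide_eq mult.commute)
  also have "\<dots> = entropy_const \<theta> r * q\<^sup>2 * (\<Sum>\<eta>\<in>Omega n. ?W \<eta> * ?D \<eta>)"
    unfolding entropy_const_def by (simp add: mult_ac)
  finally show ?thesis using that[OF c] unfolding q(2) by blast
qed

end

section \<open>Back to the Glauber dynamics and the original normalisation\<close>

lemma glauber_rate_ge:
  assumes \<eta>: "\<eta> \<in> Omega n" and x: "x < n"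
  shows "((1 - r) / 2)\<^sup>2 \<le> glauber_rate \<theta> n x \<eta>"
proof -
  let ?g = "gam \<theta> n"
  let ?a = "spin \<eta> x" and ?b = "spin \<eta> (pred_site n x)" and ?c = "spin \<eta> (succ_site n x)"
  have sp: "?a = 1 \<or> ?a = -1" "?b = 1 \<or> ?b = -1" "?c = 1 \<or> ?c = -1"
    using spin_cases[OF \<eta>] x n_pos by (auto simp: pred_site_def succ_site_def)
  \<comment> \<open>The rate factorises because the square of the spin at x is 1; each factor is at
    least 1 - \<gamma>. Coinciding neighbours, for n = 1 or 2, do no harm.\<close>
  have "glauber_rate \<theta> n x \<eta> = (1 - ?g * (?a * ?b)) * (1 - ?g * (?a * ?c))"
    using sp(1) unfolding glauber_rate_def by (auto simp: power2_eq_square algebra_simps)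
  moreover have "((1 - r) / 2) * ((1 - r) / 2) \<le> (1 - ?g * (?a * ?b)) * (1 - ?g * (?a * ?c))"
  proof -
    have "(1 - r) / 2 \<le> 1 - ?g * e" if "e = 1 \<or> e = - 1" for e :: real
      using that gam r by (auto simp: field_simps)
    moreover have "?a * ?b = 1 \<or> ?a * ?b = -1" "?a * ?c = 1 \<or> ?a * ?c = -1" using sp by auto
    ultimately have "(1 - r) / 2 \<le> 1 - ?g * (?a * ?b)" "(1 - r) / 2 \<le> 1 - ?g * (?a * ?c)" by blast+
    then show ?thesis using r by (intro mult_mono) auto
  qed
  ultimately show ?thesis by (simp add: power2_eq_square)
qed

lemma entropy_le_glauber:
  assumes dens: "prob_density_wrt (nu_U \<theta> n) f"
  shows "rel_entropy f (nu_U \<theta> n) \<le>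
    entropy_const \<theta> r * (2 / ((1 - r) / 2)\<^sup>2) * (sqrt (real n) * D_G \<theta> n f (nu_U \<theta> n))"
proof -
  interpret prob_space "nu_U \<theta> n" by (rule prob_space_nu_U)
  let ?\<nu> = "nu_U \<theta> n" and ?W = "nu_U_weight \<theta> n" and ?Z = "Z_U \<theta> n * 2 ^ n"
  let ?D = "\<lambda>\<eta>. \<Sum>x<n. (sqrt (f (flip x \<eta>)) - sqrt (f \<eta>))\<^sup>2"
  have f: "\<And>\<eta>. \<eta> \<in> Omega n \<Longrightarrow> 0 \<le> f \<eta>" and f1: "(\<integral>\<eta>. f \<eta> \<partial>?\<nu>) = 1"
    using dens by (auto simp: prob_density_wrt_def)
  have Z: "0 < ?Z" using Z_U_pos by simp
  have int: "(\<integral>\<eta>. h \<eta> \<partial>?\<nu>) = (\<Sum>\<eta>\<in>Omega n. ?W \<eta> * h \<eta>) / ?Z" for h :: "(nat \<Rightarrow> nat) \<Rightarrow> real"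
    unfolding integral_nu_U by (simp add: sum_divide_distrib)
  have f_pos: "\<exists>\<eta>\<in>Omega n. 0 < f \<eta>"
  proof (rule ccontr)
    assume "\<not> ?thesis"
    then have "f \<eta> = 0" if "\<eta> \<in> Omega n" for \<eta> using f[OF that] that by force
    then have "(\<integral>\<eta>. f \<eta> \<partial>?\<nu>) = 0" unfolding int by simp
    then show False using f1 by simp
  qed
  obtain c where c: "0 < c" and le: "(\<Sum>\<eta>\<in>Omega n. ?W \<eta> * ent_gap (f \<eta>) c) \<le>
      entropy_const \<theta> r * sqrt (real n) * (\<Sum>\<eta>\<in>Omega n. ?W \<eta> * ?D \<eta>)"
    using weighted_entropy_le[OF f f_pos] by blast
  have one: "(\<integral>\<eta>. 1 \<partial>?\<nu>) = (1::real)" using prob_space by simp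
  have "(\<integral>\<eta>. ent_gap (f \<eta>) c \<partial>?\<nu>) = rel_entropy f ?\<nu> - ln c * (\<integral>\<eta>. f \<eta> \<partial>?\<nu>) - (\<integral>\<eta>. f \<eta> \<partial>?\<nu>) + c * (\<integral>\<eta>. 1 \<partial>?\<nu>)"
    unfolding rel_entropy_def int ent_gap_def
    by (simp add: sum.distrib sum_subtractf algebra_simps add_divide_distrib diff_divide_distrib sum_distrib_left)
  \<comment> \<open>As f has mean 1, the mean gap exceeds the entropy by c - 1 - ln c, which is
    nonnegative, so the unknown c disappears here.\<close>
  then have "rel_entropy f ?\<nu> \<le> (\<integral>\<eta>. ent_gap (f \<eta>) c \<partial>?\<nu>)"
    unfolding f1 one using ln_le_minus_one[OF c] by simp
  also have "\<dots> \<le> (entropy_const \<theta> r * sqrt (real n) * (\<Sum>\<eta>\<in>Omega n. ?W \<eta> * ?D \<eta>)) / ?Z"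
    unfolding int using le Z by (intro divide_right_mono) auto
  also have "\<dots> = entropy_const \<theta> r * sqrt (real n) * (\<integral>\<eta>. ?D \<eta> \<partial>?\<nu>)" unfolding int by simp
  also have "\<dots> \<le> entropy_const \<theta> r * sqrt (real n) * (2 / ((1 - r) / 2)\<^sup>2 * D_G \<theta> n f ?\<nu>)"
  proof (intro mult_left_mono)
    have r2: "0 < ((1 - r) / 2)\<^sup>2" using r by simp
    have swap: "(\<Sum>x<n. \<integral>\<eta>. h x \<eta> \<partial>?\<nu>) = (\<integral>\<eta>. (\<Sum>x<n. h x \<eta>) \<partial>?\<nu>)" for h :: "nat \<Rightarrow> (nat \<Rightarrow> nat) \<Rightarrow> real"
      unfolding int sum_divide_distrib[symmetric] sum_distrib_left by (subst sum.swap) simp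
    have "((1 - r) / 2)\<^sup>2 * (\<integral>\<eta>. ?D \<eta> \<partial>?\<nu>) = (\<Sum>\<eta>\<in>Omega n. ?W \<eta> * (\<Sum>x<n. ((1 - r) / 2)\<^sup>2 * (sqrt (f (flip x \<eta>)) - sqrt (f \<eta>))\<^sup>2)) / ?Z"
      unfolding int times_divide_eq_right sum_distrib_left by (simp only: mult_ac)
    also have "\<dots> \<le> (\<Sum>\<eta>\<in>Omega n. ?W \<eta> * (\<Sum>x<n. glauber_rate \<theta> n x \<eta> * (sqrt (f (flip x \<eta>)) - sqrt (f \<eta>))\<^sup>2)) / ?Z"
      using Z by (intro divide_right_mono sum_mono mult_left_mono mult_right_mono glauber_rate_ge)
        (auto simp: nu_U_weight_def)
    also have "\<dots> = 2 * D_G \<theta> n f ?\<nu>" unfolding D_G_def swap unfolding int by simp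
    finally show "(\<integral>\<eta>. ?D \<eta> \<partial>?\<nu>) \<le> 2 / ((1 - r) / 2)\<^sup>2 * D_G \<theta> n f ?\<nu>"
      using r2 by (simp add: field_simps)
    show "0 \<le> entropy_const \<theta> r * sqrt (real n)"
      using entropy_const_pos by simp
  qed
  finally show ?thesis by (simp add: mult_ac)
qed

lemma D_G_nonneg: "0 \<le> D_G \<theta> n f (nu_U \<theta> n)"
proof -
  have "0 \<le> glauber_rate \<theta> n x \<eta>" if "\<eta> \<in> Omega n" "x < n" for x \<eta>
    using glauber_rate_ge[OF that] by (rule order_trans[OF zero_le_power2])
  then show ?thesis
    unfolding D_G_def by (intro mult_nonneg_nonneg sum_nonneg integral_nonneg_AE) auto
qed

end

lemma D_ex_nonneg: "0 \<le> D_ex n f M"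
  unfolding D_ex_def by (intro mult_nonneg_nonneg sum_nonneg integral_nonneg_AE) auto

theorem theorem4p1:
  fixes \<theta> :: real
  shows "\<exists>C>0.
    (\<forall>n::nat. 0 < n \<longrightarrow> \<theta>\<^sup>2 < real n \<longrightarrow>
      (\<forall>f :: (nat \<Rightarrow> nat) \<Rightarrow> real. prob_density_wrt (nu_U \<theta> n) f \<longrightarrow>
        rel_entropy f (nu_U \<theta> n)
          \<le> C * ((real n)\<^sup>2 * D_ex n f (nu_U \<theta> n) + sqrt (real n) * D_G \<theta> n f (nu_U \<theta> n)))) \<and>
    (\<forall>n::nat. 0 < n \<longrightarrow> \<theta>\<^sup>2 < real n \<longrightarrow>
      (\<forall>f :: (nat \<Rightarrow> nat) \<Rightarrow> real. prob_density_wrt (nu_U \<theta> n) f \<longrightarrow>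
        rel_entropy f (nu_U \<theta> n) \<le> C * sqrt (real n) * D_total \<theta> n f (nu_U \<theta> n)))"
proof -
  \<comment> \<open>The smallest admissible n. Since |\<theta>| / sqrt n decreases in n, its value r
    < 1 at m bounds it for every admissible n.\<close>
  define m where "m = nat \<lfloor>\<theta>\<^sup>2\<rfloor> + 1"
  define r where "r = \<bar>\<theta>\<bar> / sqrt (real m)"
  have m: "0 < m" "\<theta>\<^sup>2 < real m" unfolding m_def by (simp_all, linarith)
  then have "\<bar>\<theta>\<bar> < sqrt (real m)" by (metis real_sqrt_abs real_sqrt_less_iff)
  then have r: "0 \<le> r" "r < 1" using m by (auto simp: r_def divide_less_eq)
  have cw: "curie_weiss \<theta> r n" if n: "0 < n" "\<theta>\<^sup>2 < real n" for n
  proof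
    have "m \<le> n" using n unfolding m_def by linarith
    then have "r * sqrt (real m) \<le> r * sqrt (real n)" using r by (intro mult_left_mono) auto
    then show "\<bar>\<theta>\<bar> \<le> r * sqrt (real n)" using m by (simp add: r_def)
  qed (use n r in auto)
  \<comment> \<open>Any instance shows that the n-independent constant is positive; m is one that
    certainly exists.\<close>
  interpret m: curie_weiss \<theta> r m using cw m by blast
  define C where "C = entropy_const \<theta> r * (2 / ((1 - r) / 2)\<^sup>2)"
  have C: "0 < C" unfolding C_def using m.entropy_const_pos r by simp
  have main: "rel_entropy f (nu_U \<theta> n) \<le> C * (sqrt (real n) * D_G \<theta> n f (nu_U \<theta> n)) \<and> 0 \<le> D_G \<theta> n f (nu_U \<theta> n)"
    if "0 < n" "\<theta>\<^sup>2 < real n" "prob_density_wrt (nu_U \<theta> n) f" for n f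
  proof -
    interpret curie_weiss \<theta> r n using cw that by blast
    show ?thesis using entropy_le_glauber[OF that(3)] D_G_nonneg unfolding C_def by blast
  qed
  show ?thesis
  proof (intro exI[of _ C] conjI allI impI C)
    fix n :: nat and f :: "(nat \<Rightarrow> nat) \<Rightarrow> real"
    assume n: "0 < n" "\<theta>\<^sup>2 < real n" and f: "prob_density_wrt (nu_U \<theta> n) f"
    let ?G = "D_G \<theta> n f (nu_U \<theta> n)" and ?E = "D_ex n f (nu_U \<theta> n)"
    note H = main[OF n f]
    have E: "0 \<le> ?E" by (rule D_ex_nonneg)
    have "C * (sqrt (real n) * ?G) \<le> C * ((real n)\<^sup>2 * ?E + sqrt (real n) * ?G)"
      using C E by (intro mult_left_mono) auto
    then show "rel_entropy f (nu_U \<theta> n) \<le> C * ((real n)\<^sup>2 * ?E + sqrt (real n) * ?G)"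
      using H by linarith
    have "C * sqrt (real n) * ?G \<le> C * sqrt (real n) * D_total \<theta> n f (nu_U \<theta> n)"
      unfolding D_total_def using C E by (intro mult_left_mono) auto
    then show "rel_entropy f (nu_U \<theta> n) \<le> C * sqrt (real n) * D_total \<theta> n f (nu_U \<theta> n)"
      using H by (simp add: mult.assoc)
  qed
qed

end
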